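(* In Zermelo-Fraenkel set theory without the Axiom of Choice, the Principle of Dependent Choices (DC) implies the gauge variational principle (EVPg-P3-L1); hence (DC) implies (EVPg-P$j$-L$k$) for all $j\in\{3,4\}$ and all $k\in\{1,2,3\}$.
   Context: (DC): for every nonempty set $M$, every relation $\mathcal{R}$ on $M$ such that $\mathcal{R}(x):=\{y\in M: x\mathcal{R}y\}$ is nonempty for each $x\in M$, and every $a\in M$, there is a sequence $(x_n;\,n\ge0)$ in $M$ with $x_0=a$ and $x_{n+1}\in\mathcal{R}(x_n)$ for all $n\ge0$. A quasi-order is a reflexive and transitive relation. A semimetric on $X$ is a map $d:X\times X\to[0,\infty)$ that is symmetric, satisfies the triangle inequality, and has $d(x,x)=0$ for all $x$. A family $D=(d_i;\,i\ge0)$ of semimetrics is sufficient if $d_i(x,y)=0$ for all $i\ge 0$ implies $x=y$. A sequence $(x_n)$ in $X$ $D$-converges to $x$ (written $x_n\to_D x$; $x$ is the $D$-limit) if $d_i(x_n,x)\to0$ for each $i\ge0$; it is $D$-Cauchy if $d_i(x_m,x_n)\to0$ as $m,n\to\infty$ for each $i\ge 0$. A sequence is ascending if $x_n\le x_m$ whenever $n\le m$. $(X;\le;D)$ is complete if every ascending $D$-Cauchy sequence is $D$-convergent; $\le$ is $D$-self-closed if the $D$-limit of each ascending $D$-convergent sequence is an upper bound of that sequence; $(X;\le;D)$ is strongly complete if it is complete and $\le$ is $D$-self-closed. For $\varphi:X\to\mathbb{R}\cup\{\infty\}$, $\mathrm{Dom}(\varphi)=\{x\in X:\varphi(x)<\infty\}$.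 Subclasses of such functions: (P3) $\inf\varphi(X)>-\infty$; (P4) $\inf\varphi(X)\ge0$; (L1) if $(x_n)$ is ascending, $x_n\to_D x$, $x_n\le x$ for all $n$, and $(\varphi(x_n))$ is descending, then $\varphi(x_n)\ge\varphi(x)$ for all $n$; (L2) if $x_n\to_D x$ and $(\varphi(x_n))$ is descending, then $\varphi(x_n)\ge\varphi(x)$ for all $n$; (L3) if $x_n\to_D x$, then $\liminf_n\varphi(x_n)\ge\varphi(x)$. (EVPg-P$j$-L$k$): for every quasi-ordered set $(X,\le)$ and every sufficient denumerable family $D=(d_i;\,i\ge0)$ of semimetrics on $X$ such that $(X;\le;D)$ is strongly complete, and every sequence $\Phi=(\varphi_i;\,i\ge0)$ of functions $X\to\mathbb{R}\cup\{\infty\}$ with $\mathrm{Dom}(\Phi):=\bigcap_{i\ge0}\mathrm{Dom}(\varphi_i)\ne\emptyset$, all $\varphi_i$ in (P$j$) and all $\varphi_i$ in (L$k$), it holds that for each $u\in\mathrm{Dom}(\Phi)$ there is $v\in\mathrm{Dom}(\Phi)$ with $u\le v$, $d_i(u,v)\le\varphi_i(u)-\varphi_i(v)$ for all $i\ge0$, and such that for every $x\in X$ with $v\le x$, $x\neq v$, there is an index $i$ with $d_i(v,x)>\varphi_i(v)-\varphi_i(x)$. *)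

theory Defs
  imports Main
begin

text \<open>
  Isabelle/HOL itself has a choice operator, so an implication that is to be a theorem of ZF
  without Choice cannot be stated about HOL sets: there DC would hold outright. It is stated
  instead as a consequence over ZF: an arbitrary model of first-order ZF is given as a HOL type
  \<open>'v\<close> with a binary relation \<open>mem\<close>, and DC and the variational principles are read inside that
  model, that is, all sets, relations, functions and sequences are elements of \<open>'v\<close>. Models may
  be non-standard.
\<close>

text \<open>
  The Separation and Replacement schemas range over first-order formulas of set theory only.
  With arbitrary HOL predicates in their place, HOL's choice operator would make every model
  satisfy the Axiom of Choice.
\<close>

datatype fm = Mem nat nat | Eq nat nat | Neg fm | Conj fm fm | All nat fm

locale membership =
  fixes mem :: "'v \<Rightarrow> 'v \<Rightarrow> bool"  (infix \<open>\<epsilon>\<close> 50)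
begin

primrec sat :: "(nat \<Rightarrow> 'v) \<Rightarrow> fm \<Rightarrow> bool" where
  "sat s (Mem i j) \<longleftrightarrow> s i \<epsilon> s j"
| "sat s (Eq i j) \<longleftrightarrow> s i = s j"
| "sat s (Neg p) \<longleftrightarrow> \<not> sat s p"
| "sat s (Conj p q) \<longleftrightarrow> sat s p \<and> sat s q"
| "sat s (All i p) \<longleftrightarrow> (\<forall>a. sat (s(i := a)) p)"

abbreviation elts :: "'v \<Rightarrow> 'v set" where
  "elts A \<equiv> {x. x \<epsilon> A}"

end

locale ZF = membership +
  assumes extensionality: "(\<forall>z. z \<epsilon> x \<longleftrightarrow> z \<epsilon> y) \<Longrightarrow> x = y"
    and foundation: "\<exists>y. y \<epsilon> x \<Longrightarrow> \<exists>y. y \<epsilon> x \<and> \<not> (\<exists>z. z \<epsilon> x \<and> z \<epsilon> y)"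
    and pairing: "\<exists>z. \<forall>w. w \<epsilon> z \<longleftrightarrow> w = x \<or> w = y"
    and union: "\<exists>z. \<forall>w. w \<epsilon> z \<longleftrightarrow> (\<exists>y. y \<epsilon> x \<and> w \<epsilon> y)"
    and power_set: "\<exists>z. \<forall>w. w \<epsilon> z \<longleftrightarrow> (\<forall>y. y \<epsilon> w \<longrightarrow> y \<epsilon> x)"
    and infinity: "\<exists>z. (\<exists>e. e \<epsilon> z \<and> (\<forall>w. \<not> w \<epsilon> e)) \<and>
      (\<forall>x. x \<epsilon> z \<longrightarrow> (\<exists>y. y \<epsilon> z \<and> (\<forall>w. w \<epsilon> y \<longleftrightarrow> w \<epsilon> x \<or> w = x)))"
    and separation: "\<exists>z. \<forall>x. x \<epsilon> z \<longleftrightarrow> x \<epsilon> A \<and> sat (s(0 := x)) p"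
    and replacement:
      "(\<forall>x y y'. x \<epsilon> A \<and> sat (s(0 := x, 1 := y)) p \<and> sat (s(0 := x, 1 := y')) p \<longrightarrow> y = y') \<Longrightarrow>
       \<exists>z. \<forall>y. y \<epsilon> z \<longleftrightarrow> (\<exists>x. x \<epsilon> A \<and> sat (s(0 := x, 1 := y)) p)"

context membership
begin

text \<open>
  The class term \<open>{x | P x}\<close> as an element of the model. It is only used for \<open>P\<close> that are
  first-order over the model and for which ZF proves that the extension is a set.
\<close>

definition set_of :: "('v \<Rightarrow> bool) \<Rightarrow> 'v" where
  "set_of P = (THE z. \<forall>x. x \<epsilon> z \<longleftrightarrow> P x)"

definition empty :: 'v where
  "empty = set_of (\<lambda>x. False)"

definition upair :: "'v \<Rightarrow> 'v \<Rightarrow> 'v" where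
  "upair a b = set_of (\<lambda>x. x = a \<or> x = b)"

definition opair :: "'v \<Rightarrow> 'v \<Rightarrow> 'v" where
  "opair a b = upair (upair a a) (upair a b)"

definition cart :: "'v \<Rightarrow> 'v \<Rightarrow> 'v" where
  "cart A B = set_of (\<lambda>p. \<exists>a\<in>elts A. \<exists>b\<in>elts B. p = opair a b)"

definition succ :: "'v \<Rightarrow> 'v" where
  "succ n = set_of (\<lambda>x. x \<epsilon> n \<or> x = n)"

definition omega :: 'v where
  "omega = set_of (\<lambda>n. \<forall>I. empty \<epsilon> I \<and> (\<forall>k\<in>elts I. succ k \<epsilon> I) \<longrightarrow> n \<epsilon> I)"

definition nat_le :: "'v \<Rightarrow> 'v \<Rightarrow> bool" where
  "nat_le n m \<longleftrightarrow> n \<epsilon> m \<or> n = m"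

definition is_fun :: "'v \<Rightarrow> 'v \<Rightarrow> 'v \<Rightarrow> bool" where
  "is_fun f A B \<longleftrightarrow> elts f \<subseteq> elts (cart A B) \<and> (\<forall>x\<in>elts A. \<exists>!y. opair x y \<epsilon> f)"

definition funspace :: "'v \<Rightarrow> 'v \<Rightarrow> 'v" where
  "funspace A B = set_of (\<lambda>f. is_fun f A B)"

definition app :: "'v \<Rightarrow> 'v \<Rightarrow> 'v" where
  "app f x = (THE y. opair x y \<epsilon> f)"

definition app2 :: "'v \<Rightarrow> 'v \<Rightarrow> 'v \<Rightarrow> 'v" where
  "app2 f x y = app f (opair x y)"

definition is_rel :: "'v \<Rightarrow> 'v \<Rightarrow> bool" where
  "is_rel r M \<longleftrightarrow> elts r \<subseteq> elts (cart M M)"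

definition DC :: bool where
  "DC \<longleftrightarrow> (\<forall>M r a.
     elts M \<noteq> {} \<and> is_rel r M \<and> (\<forall>x\<in>elts M. \<exists>y\<in>elts M. opair x y \<epsilon> r) \<and> a \<epsilon> M \<longrightarrow>
     (\<exists>f. is_fun f omega M \<and> app f empty = a \<and>
          (\<forall>n\<in>elts omega. opair (app f n) (app f (succ n)) \<epsilon> r)))"

definition quasi_order :: "'v \<Rightarrow> 'v \<Rightarrow> bool" where
  "quasi_order X r \<longleftrightarrow> is_rel r X \<and> (\<forall>x\<in>elts X. opair x x \<epsilon> r) \<and>
     (\<forall>x\<in>elts X. \<forall>y\<in>elts X. \<forall>z\<in>elts X. opair x y \<epsilon> r \<and> opair y z \<epsilon> r \<longrightarrow> opair x z \<epsilon> r)"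

definition ascending :: "'v \<Rightarrow> 'v \<Rightarrow> bool" where
  "ascending r f \<longleftrightarrow> (\<forall>n\<in>elts omega. \<forall>m\<in>elts omega.
     nat_le n m \<longrightarrow> opair (app f n) (app f m) \<epsilon> r)"

end

text \<open>
  A system of extended real numbers in the model: a carrier, the graphs of addition and
  multiplication, zero, one, the order relation, and two objects standing for \<open>\<infinity>\<close> and \<open>- \<infinity>\<close>.
\<close>

locale real_data = membership mem
  for mem :: "'v \<Rightarrow> 'v \<Rightarrow> bool"  (infix \<open>\<epsilon>\<close> 50) +
  fixes reals add mul zero one ord pinf minf :: 'v
begin

abbreviation plus_R :: "'v \<Rightarrow> 'v \<Rightarrow> 'v"  (infixl \<open>\<oplus>\<close> 65) where
  "x \<oplus> y \<equiv> app2 add x y"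

abbreviation times_R :: "'v \<Rightarrow> 'v \<Rightarrow> 'v"  (infixl \<open>\<otimes>\<close> 70) where
  "x \<otimes> y \<equiv> app2 mul x y"

abbreviation le_R :: "'v \<Rightarrow> 'v \<Rightarrow> bool"  (infix \<open>\<preceq>\<close> 50) where
  "x \<preceq> y \<equiv> opair x y \<epsilon> ord"

definition ext_reals :: 'v where
  "ext_reals = set_of (\<lambda>x. x \<epsilon> reals \<or> x = pinf \<or> x = minf)"

definition reals_pinf :: 'v where
  "reals_pinf = set_of (\<lambda>x. x \<epsilon> reals \<or> x = pinf)"

definition ext_le :: "'v \<Rightarrow> 'v \<Rightarrow> bool"  (infix \<open>\<sqsubseteq>\<close> 50) where
  "a \<sqsubseteq> b \<longleftrightarrow> a = minf \<or> b = pinf \<or> (a \<epsilon> reals \<and> b \<epsilon> reals \<and> a \<preceq> b)"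

definition ext_less :: "'v \<Rightarrow> 'v \<Rightarrow> bool"  (infix \<open>\<sqsubset>\<close> 50) where
  "a \<sqsubset> b \<longleftrightarrow> a \<sqsubseteq> b \<and> a \<noteq> b"

definition ext_inf :: "'v \<Rightarrow> 'v" where
  "ext_inf A = (THE m. m \<epsilon> ext_reals \<and> (\<forall>a\<in>elts A. m \<sqsubseteq> a) \<and>
     (\<forall>l\<in>elts ext_reals. (\<forall>a\<in>elts A. l \<sqsubseteq> a) \<longrightarrow> l \<sqsubseteq> m))"

definition ext_sup :: "'v \<Rightarrow> 'v" where
  "ext_sup A = (THE m. m \<epsilon> ext_reals \<and> (\<forall>a\<in>elts A. a \<sqsubseteq> m) \<and>
     (\<forall>u\<in>elts ext_reals. (\<forall>a\<in>elts A. a \<sqsubseteq> u) \<longrightarrow> m \<sqsubseteq> u))"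

text \<open>Subtraction is needed only for real \<open>a\<close> and \<open>b\<close> real or \<open>\<infinity>\<close>, with \<open>a - \<infinity> = - \<infinity>\<close>.\<close>

definition ext_diff :: "'v \<Rightarrow> 'v \<Rightarrow> 'v"  (infixl \<open>\<ominus>\<close> 65) where
  "a \<ominus> b = (if b = pinf then minf else (THE c. c \<epsilon> reals \<and> c \<oplus> b = a))"

text \<open>In the following, \<open>d\<close> is a function on \<open>X \<times> X\<close> and \<open>D\<close> a sequence of such functions.\<close>

definition semimetric :: "'v \<Rightarrow> 'v \<Rightarrow> bool" where
  "semimetric X d \<longleftrightarrow> is_fun d (cart X X) reals \<and>
     (\<forall>x\<in>elts X. \<forall>y\<in>elts X. zero \<preceq> app2 d x y) \<and>
     (\<forall>x\<in>elts X. \<forall>y\<in>elts X. app2 d x y = app2 d y x) \<and>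
     (\<forall>x\<in>elts X. \<forall>y\<in>elts X. \<forall>z\<in>elts X. app2 d x z \<preceq> app2 d x y \<oplus> app2 d y z) \<and>
     (\<forall>x\<in>elts X. app2 d x x = zero)"

definition semimetric_family :: "'v \<Rightarrow> 'v \<Rightarrow> bool" where
  "semimetric_family X D \<longleftrightarrow> is_fun D omega (funspace (cart X X) reals) \<and>
     (\<forall>i\<in>elts omega. semimetric X (app D i))"

definition sufficient :: "'v \<Rightarrow> 'v \<Rightarrow> bool" where
  "sufficient X D \<longleftrightarrow> (\<forall>x\<in>elts X. \<forall>y\<in>elts X.
     (\<forall>i\<in>elts omega. app2 (app D i) x y = zero) \<longrightarrow> x = y)"

definition D_limit :: "'v \<Rightarrow> 'v \<Rightarrow> 'v \<Rightarrow> bool" where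
  "D_limit D f x \<longleftrightarrow> (\<forall>i\<in>elts omega. \<forall>e\<in>elts reals. zero \<sqsubset> e \<longrightarrow>
     (\<exists>N\<in>elts omega. \<forall>n\<in>elts omega. nat_le N n \<longrightarrow> app2 (app D i) (app f n) x \<sqsubset> e))"

definition D_Cauchy :: "'v \<Rightarrow> 'v \<Rightarrow> bool" where
  "D_Cauchy D f \<longleftrightarrow> (\<forall>i\<in>elts omega. \<forall>e\<in>elts reals. zero \<sqsubset> e \<longrightarrow>
     (\<exists>N\<in>elts omega. \<forall>m\<in>elts omega. \<forall>n\<in>elts omega. nat_le N m \<and> nat_le N n \<longrightarrow>
        app2 (app D i) (app f m) (app f n) \<sqsubset> e))"

definition complete :: "'v \<Rightarrow> 'v \<Rightarrow> 'v \<Rightarrow> bool" where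
  "complete X r D \<longleftrightarrow> (\<forall>f. is_fun f omega X \<and> ascending r f \<and> D_Cauchy D f \<longrightarrow>
     (\<exists>x\<in>elts X. D_limit D f x))"

definition self_closed :: "'v \<Rightarrow> 'v \<Rightarrow> 'v \<Rightarrow> bool" where
  "self_closed X r D \<longleftrightarrow> (\<forall>f. \<forall>x\<in>elts X. is_fun f omega X \<and> ascending r f \<and> D_limit D f x \<longrightarrow>
     (\<forall>n\<in>elts omega. opair (app f n) x \<epsilon> r))"

definition strongly_complete :: "'v \<Rightarrow> 'v \<Rightarrow> 'v \<Rightarrow> bool" where
  "strongly_complete X r D \<longleftrightarrow> complete X r D \<and> self_closed X r D"

definition Dom :: "'v \<Rightarrow> 'v \<Rightarrow> 'v" where
  "Dom X \<phi> = set_of (\<lambda>x. x \<epsilon> X \<and> app \<phi> x \<sqsubset> pinf)"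

definition Dom_family :: "'v \<Rightarrow> 'v \<Rightarrow> 'v" where
  "Dom_family X \<Phi> = set_of (\<lambda>x. \<forall>i\<in>elts omega. x \<epsilon> Dom X (app \<Phi> i))"

definition range_inf :: "'v \<Rightarrow> 'v \<Rightarrow> 'v" where
  "range_inf X \<phi> = ext_inf (set_of (\<lambda>a. \<exists>x\<in>elts X. a = app \<phi> x))"

definition descending_along :: "'v \<Rightarrow> 'v \<Rightarrow> bool" where
  "descending_along \<phi> f \<longleftrightarrow> (\<forall>n\<in>elts omega. \<forall>m\<in>elts omega.
     nat_le n m \<longrightarrow> app \<phi> (app f m) \<sqsubseteq> app \<phi> (app f n))"

definition liminf_along :: "'v \<Rightarrow> 'v \<Rightarrow> 'v" where
  "liminf_along \<phi> f = ext_sup (set_of (\<lambda>a. \<exists>n\<in>elts omega.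
     a = ext_inf (set_of (\<lambda>b. \<exists>m\<in>elts omega. nat_le n m \<and> b = app \<phi> (app f m)))))"

end

datatype bound_class = P3 | P4

datatype lsc_class = L1 | L2 | L3

context real_data
begin

primrec in_P :: "bound_class \<Rightarrow> 'v \<Rightarrow> 'v \<Rightarrow> bool" where
  "in_P P3 X \<phi> \<longleftrightarrow> minf \<sqsubset> range_inf X \<phi>"
| "in_P P4 X \<phi> \<longleftrightarrow> zero \<sqsubseteq> range_inf X \<phi>"

primrec in_L :: "lsc_class \<Rightarrow> 'v \<Rightarrow> 'v \<Rightarrow> 'v \<Rightarrow> 'v \<Rightarrow> bool" where
  "in_L L1 X r D \<phi> \<longleftrightarrow> (\<forall>f. \<forall>x\<in>elts X. is_fun f omega X \<and> ascending r f \<and> D_limit D f x \<and>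
     (\<forall>n\<in>elts omega. opair (app f n) x \<epsilon> r) \<and> descending_along \<phi> f \<longrightarrow>
     (\<forall>n\<in>elts omega. app \<phi> x \<sqsubseteq> app \<phi> (app f n)))"
| "in_L L2 X r D \<phi> \<longleftrightarrow> (\<forall>f. \<forall>x\<in>elts X. is_fun f omega X \<and> D_limit D f x \<and>
     descending_along \<phi> f \<longrightarrow>
     (\<forall>n\<in>elts omega. app \<phi> x \<sqsubseteq> app \<phi> (app f n)))"
| "in_L L3 X r D \<phi> \<longleftrightarrow> (\<forall>f. \<forall>x\<in>elts X. is_fun f omega X \<and> D_limit D f x \<longrightarrow>
     app \<phi> x \<sqsubseteq> liminf_along \<phi> f)"

definition EVPg_over :: "bound_class \<Rightarrow> lsc_class \<Rightarrow> bool" where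
  "EVPg_over j k \<longleftrightarrow> (\<forall>X r D \<Phi>.
     quasi_order X r \<and> semimetric_family X D \<and> sufficient X D \<and> strongly_complete X r D \<and>
     is_fun \<Phi> omega (funspace X reals_pinf) \<and> elts (Dom_family X \<Phi>) \<noteq> {} \<and>
     (\<forall>i\<in>elts omega. in_P j X (app \<Phi> i)) \<and> (\<forall>i\<in>elts omega. in_L k X r D (app \<Phi> i)) \<longrightarrow>
     (\<forall>u\<in>elts (Dom_family X \<Phi>). \<exists>v\<in>elts (Dom_family X \<Phi>).
        opair u v \<epsilon> r \<and>
        (\<forall>i\<in>elts omega. app2 (app D i) u v \<sqsubseteq> app (app \<Phi> i) u \<ominus> app (app \<Phi> i) v) \<and>
        (\<forall>x\<in>elts X. opair v x \<epsilon> r \<and> x \<noteq> v \<longrightarrow>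
           (\<exists>i\<in>elts omega. app (app \<Phi> i) v \<ominus> app (app \<Phi> i) x \<sqsubset> app2 (app D i) v x))))"

end

text \<open>
  The real numbers of the model are any Dedekind complete ordered field in it. ZF proves that one
  exists and that it is unique up to isomorphism, so the universal quantification over all of them
  below amounts to fixing a construction. In \<open>dedekind_complete\<close>, as in everything else, \<open>S\<close> ranges
  over sets of the model.
\<close>

locale real_line = real_data +
  assumes add_fun: "is_fun add (cart reals reals) reals"
    and mul_fun: "is_fun mul (cart reals reals) reals"
    and zero_real: "zero \<epsilon> reals"
    and one_real: "one \<epsilon> reals"
    and zero_neq_one: "zero \<noteq> one"
    and add_assoc: "\<lbrakk>x \<epsilon> reals; y \<epsilon> reals; z \<epsilon> reals\<rbrakk> \<Longrightarrow> (x \<oplus> y) \<oplus> z = x \<oplus> (y \<oplus> z)"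
    and add_commute: "\<lbrakk>x \<epsilon> reals; y \<epsilon> reals\<rbrakk> \<Longrightarrow> x \<oplus> y = y \<oplus> x"
    and add_zero: "x \<epsilon> reals \<Longrightarrow> x \<oplus> zero = x"
    and add_inverse: "x \<epsilon> reals \<Longrightarrow> \<exists>y\<in>elts reals. x \<oplus> y = zero"
    and mul_assoc: "\<lbrakk>x \<epsilon> reals; y \<epsilon> reals; z \<epsilon> reals\<rbrakk> \<Longrightarrow> (x \<otimes> y) \<otimes> z = x \<otimes> (y \<otimes> z)"
    and mul_commute: "\<lbrakk>x \<epsilon> reals; y \<epsilon> reals\<rbrakk> \<Longrightarrow> x \<otimes> y = y \<otimes> x"
    and mul_one: "x \<epsilon> reals \<Longrightarrow> x \<otimes> one = x"
    and mul_inverse: "\<lbrakk>x \<epsilon> reals; x \<noteq> zero\<rbrakk> \<Longrightarrow> \<exists>y\<in>elts reals. x \<otimes> y = one"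
    and distrib: "\<lbrakk>x \<epsilon> reals; y \<epsilon> reals; z \<epsilon> reals\<rbrakk> \<Longrightarrow> x \<otimes> (y \<oplus> z) = (x \<otimes> y) \<oplus> (x \<otimes> z)"
    and ord_rel: "is_rel ord reals"
    and ord_refl: "x \<epsilon> reals \<Longrightarrow> x \<preceq> x"
    and ord_antisym: "\<lbrakk>x \<preceq> y; y \<preceq> x\<rbrakk> \<Longrightarrow> x = y"
    and ord_trans: "\<lbrakk>x \<preceq> y; y \<preceq> z\<rbrakk> \<Longrightarrow> x \<preceq> z"
    and ord_total: "\<lbrakk>x \<epsilon> reals; y \<epsilon> reals\<rbrakk> \<Longrightarrow> x \<preceq> y \<or> y \<preceq> x"
    and add_mono: "\<lbrakk>x \<preceq> y; z \<epsilon> reals\<rbrakk> \<Longrightarrow> x \<oplus> z \<preceq> y \<oplus> z"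
    and mul_nonneg: "\<lbrakk>zero \<preceq> x; zero \<preceq> y\<rbrakk> \<Longrightarrow> zero \<preceq> x \<otimes> y"
    and dedekind_complete:
      "\<lbrakk>elts S \<subseteq> elts reals; elts S \<noteq> {}; \<exists>b\<in>elts reals. \<forall>x\<in>elts S. x \<preceq> b\<rbrakk> \<Longrightarrow>
       \<exists>b\<in>elts reals. (\<forall>x\<in>elts S. x \<preceq> b) \<and>
         (\<forall>c\<in>elts reals. (\<forall>x\<in>elts S. x \<preceq> c) \<longrightarrow> b \<preceq> c)"
    and pinf_not_real: "\<not> pinf \<epsilon> reals"
    and minf_not_real: "\<not> minf \<epsilon> reals"
    and pinf_neq_minf: "pinf \<noteq> minf"

definition (in membership) EVPg :: "bound_class \<Rightarrow> lsc_class \<Rightarrow> bool" where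
  "EVPg j k \<longleftrightarrow> (\<forall>reals add mul zero one ord pinf minf.
     real_line mem reals add mul zero one ord pinf minf \<longrightarrow>
     real_data.EVPg_over mem reals add zero ord pinf minf j k)"

end

theory Submission
  imports Defs
begin

text \<open>
  The proof is a maximality argument for countably many functionals at once. On the common domain of
  the \<open>\<phi>\<^sub>i\<close> put \<open>x\<close> below \<open>y\<close> if \<open>x \<le> y\<close> and \<open>d\<^sub>i(x,y) \<le> \<phi>\<^sub>i(x) - \<phi>\<^sub>i(y)\<close> for all \<open>i\<close>. This is a partial
  order along which every \<open>\<phi>\<^sub>i\<close> decreases, and the principle says that above each point there is a
  maximal one. Since \<open>\<phi>\<^sub>i\<close> is bounded below, above every point there is one from which \<open>\<phi>\<^sub>i\<close> can only
  decrease by \<open>e\<close> more. This property persists on the way up, so it can be arranged for finitely many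
  \<open>i\<close> (\<open>exists_near_initial\<close>), and DC gives an ascending sequence along which it holds for every \<open>i\<close>
  and every \<open>e > 0\<close> from some point on (\<open>approximating_sequence\<close>). The sequence is therefore Cauchy, and
  its limit is the maximal point (\<open>maximal_above\<close>). The weaker variants follow as (P4) implies (P3),
  and (L3) implies (L2), which implies (L1); the implication from (L3) compares the limit inferior of a
  descending sequence with its terms (\<open>liminf_le_if_descending\<close>).

  DC is used only twice: for a null sequence of positive reals and for the approximating sequence.

  Everything takes place inside a model of ZF whose natural numbers may be non-standard. So every
  subset that is formed and every induction over \<open>omega\<close> needs a first-order formula. To keep these
  formulas implicit, a predicate over assignments is called \<open>definable\<close> if some formula with parameters
  expresses it. The closure properties collected in \<open>definability\<close> are introduction rules that follow
  the syntax of a HOL formula, quantifiers included, so a definability goal is solved by resolution.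
  Separation (\<open>definable_separation\<close>), induction (\<open>omega_induct\<close>), and dependent choice
  (\<open>dependent_choice\<close>) are then stated for definable predicates.
\<close>

section \<open>Predicates definable with parameters\<close>

text \<open>
  A renaming acts on bound variables as well. For an injective renaming no variable is captured,
  and satisfaction changes only by reading the assignment at the renamed places.
\<close>

primrec rename :: "(nat \<Rightarrow> nat) \<Rightarrow> fm \<Rightarrow> fm" where
  "rename \<sigma> (Mem i j) = Mem (\<sigma> i) (\<sigma> j)"
| "rename \<sigma> (Eq i j) = Eq (\<sigma> i) (\<sigma> j)"
| "rename \<sigma> (Neg p) = Neg (rename \<sigma> p)"
| "rename \<sigma> (Conj p q) = Conj (rename \<sigma> p) (rename \<sigma> q)"
| "rename \<sigma> (All i p) = All (\<sigma> i) (rename \<sigma> p)"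

primrec var_bound :: "fm \<Rightarrow> nat" where
  "var_bound (Mem i j) = Suc (max i j)"
| "var_bound (Eq i j) = Suc (max i j)"
| "var_bound (Neg p) = var_bound p"
| "var_bound (Conj p q) = max (var_bound p) (var_bound q)"
| "var_bound (All i p) = max (Suc i) (var_bound p)"

context membership
begin

lemma sat_rename:
  assumes "inj \<sigma>"
  shows "sat s (rename \<sigma> p) \<longleftrightarrow> sat (\<lambda>i. s (\<sigma> i)) p"
proof (induction p arbitrary: s)
  case (All i p)
  have "(\<lambda>j. (s(\<sigma> i := a)) (\<sigma> j)) = (\<lambda>j. s (\<sigma> j))(i := a)" for a
    using assms by (auto simp: fun_eq_iff dest: injD)
  with All show ?case by simp
qed auto

lemma sat_cong: "(\<And>i. i < var_bound p \<Longrightarrow> s i = s' i) \<Longrightarrow> sat s p \<longleftrightarrow> sat s' p"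
proof (induction p arbitrary: s s')
  case (Conj p q)
  from Conj.IH(1)[of s s'] Conj.IH(2)[of s s'] Conj.prems show ?case by simp
next
  case (All i p)
  have "sat (s(i := a)) p \<longleftrightarrow> sat (s'(i := a)) p" for a
    using All.prems by (intro All.IH) simp
  then show ?case by simp
next
  case (Neg p)
  from Neg.IH[of s s'] Neg.prems show ?case by simp
qed simp_all

definition with_params :: "nat \<Rightarrow> (nat \<Rightarrow> 'v) \<Rightarrow> (nat \<Rightarrow> 'v) \<Rightarrow> nat \<Rightarrow> 'v" where
  "with_params k e s = (\<lambda>n. if n < k then e n else s (n - k))"

text \<open>
  Separation applies to a predicate only once a formula for it has been found. The following notion
  finds the formula by resolution. The argument of a predicate is an assignment \<open>s\<close> of its free
  variables, numbered as de Bruijn indices: below a quantifier \<open>s 0\<close> is the bound variable and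
  \<open>\<lambda>n. s (Suc n)\<close> is the old assignment. The finitely many parameters \<open>e 0, \<dots>, e (k - 1)\<close> occupy
  the places before the variables, so every element of the model may occur as a constant.
\<close>

definition definable :: "((nat \<Rightarrow> 'v) \<Rightarrow> bool) \<Rightarrow> bool" where
  "definable P \<longleftrightarrow> (\<exists>k e p. \<forall>s. P s \<longleftrightarrow> sat (with_params k e s) p)"

text \<open>
  A function is definable if its graph is. Function symbols without a counterpart in the language of
  set theory may then occur at any place in a definable predicate.
\<close>

definition definable_term :: "((nat \<Rightarrow> 'v) \<Rightarrow> 'v) \<Rightarrow> bool" where
  "definable_term T \<longleftrightarrow> definable (\<lambda>s. s 0 = T (\<lambda>n. s (Suc n)))"

lemma definableI: "(\<And>s. P s \<longleftrightarrow> sat (with_params k e s) p) \<Longrightarrow> definable P"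
  unfolding definable_def by (intro exI allI)

lemma definableE:
  assumes "definable P"
  obtains k e p where "\<And>s. P s \<longleftrightarrow> sat (with_params k e s) p"
  using assms unfolding definable_def by auto

lemma definable_not:
  assumes "definable P"
  shows "definable (\<lambda>s. \<not> P s)"
proof -
  obtain k e p where "P s \<longleftrightarrow> sat (with_params k e s) p" for s
    by (rule definableE[OF assms(1)]) blast
  then have "\<not> P s \<longleftrightarrow> sat (with_params k e s) (Neg p)" for s by simp
  then show ?thesis by (rule definableI)
qed

lemma definable_conj:
  assumes "definable P" "definable Q"
  shows "definable (\<lambda>s. P s \<and> Q s)"
proof -
  obtain k e p where P: "P s \<longleftrightarrow> sat (with_params k e s) p" for s
    by (rule definableE[OF assms(1)]) blast
  obtain l e' q where Q: "Q s \<longleftrightarrow> sat (with_params l e' s) q" for s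
    by (rule definableE[OF assms(2)]) blast
  let ?e = "with_params k e e'"
  \<comment> \<open>The parameters of both formulas are put one after the other; the variables of the first formula
    and the whole second formula move up accordingly.\<close>
  define \<sigma> where "\<sigma> = (\<lambda>i. if i < k then i else i + l)"
  define \<tau> where "\<tau> = (\<lambda>i. i + k)"
  have "inj \<sigma>" "inj \<tau>"
    by (auto simp: inj_def \<sigma>_def \<tau>_def)
  moreover have "(\<lambda>i. with_params (k + l) ?e s (\<sigma> i)) = with_params k e s" for s
    by (auto simp: fun_eq_iff \<sigma>_def with_params_def)
  moreover have "(\<lambda>i. with_params (k + l) ?e s (\<tau> i)) = with_params l e' s" for s
    by (auto simp: fun_eq_iff \<tau>_def with_params_def)
  ultimately have "P s \<and> Q s \<longleftrightarrow> sat (with_params (k + l) ?e s) (Conj (rename \<sigma> p) (rename \<tau> q))" for s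
    by (simp add: P Q sat_rename)
  then show ?thesis by (rule definableI)
qed

lemma definable_all:
  assumes "definable (\<lambda>s. R (\<lambda>n. s (Suc n)) (s 0))"
  shows "definable (\<lambda>s. \<forall>a. R s a)"
proof -
  obtain k e p where p: "R (\<lambda>n. s (Suc n)) (s 0) \<longleftrightarrow> sat (with_params k e s) p" for s
    by (rule definableE[OF assms(1)]) blast
  \<comment> \<open>The variable \<open>a\<close>, at place \<open>k\<close> after the parameters, moves to the fresh place \<open>m\<close>, where it is
    then quantified. The places in between close up, which makes the renaming injective.\<close>
  define m where "m = Suc (k + var_bound p)"
  define \<sigma> where "\<sigma> = (\<lambda>i. if i = k then m else if k < i \<and> i \<le> m then i - 1 else i)"
  have inj: "inj \<sigma>"
    by (auto simp: inj_def \<sigma>_def m_def split: if_splits)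
  have "R s a \<longleftrightarrow> sat ((with_params k e s)(m := a)) (rename \<sigma> p)" for s a
  proof -
    have "R s a \<longleftrightarrow> sat (with_params k e (case_nat a s)) p"
      using p[of "case_nat a s"] by simp
    also have "\<dots> \<longleftrightarrow> sat (\<lambda>i. ((with_params k e s)(m := a)) (\<sigma> i)) p"
    proof (rule sat_cong)
      fix i assume "i < var_bound p"
      then consider "i < k" | "i = k" | j where "i = Suc (k + j)" "i < m"
        unfolding m_def by (metis less_imp_Suc_add linorder_neqE_nat less_SucI trans_less_add2)
      then show "with_params k e (case_nat a s) i = ((with_params k e s)(m := a)) (\<sigma> i)"
        by cases (auto simp: with_params_def \<sigma>_def m_def Suc_diff_le)
    qed
    finally show ?thesis by (simp add: sat_rename[OF inj])
  qed
  then have "(\<forall>a. R s a) \<longleftrightarrow> sat (with_params k e s) (All m (rename \<sigma> p))" for s by simp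
  then show ?thesis by (rule definableI)
qed

lemma definable_rename:
  assumes "definable P" "inj \<rho>"
  shows "definable (\<lambda>s. P (\<lambda>n. s (\<rho> n)))"
proof -
  obtain k e p where P: "P s \<longleftrightarrow> sat (with_params k e s) p" for s
    by (rule definableE[OF assms(1)]) blast
  define \<sigma> where "\<sigma> = (\<lambda>i. if i < k then i else \<rho> (i - k) + k)"
  have inj: "inj \<sigma>"
    unfolding inj_def
  proof (intro allI impI)
    fix x y assume eq: "\<sigma> x = \<sigma> y"
    then have "x < k \<longleftrightarrow> y < k" by (simp add: \<sigma>_def split: if_splits)
    with eq have "x = y \<or> \<not> x < k \<and> \<not> y < k \<and> \<rho> (x - k) = \<rho> (y - k)"
      by (simp add: \<sigma>_def split: if_splits)
    then show "x = y" using injD[OF assms(2)] by fastforce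
  qed
  have "(\<lambda>i. with_params k e s (\<sigma> i)) = with_params k e (\<lambda>n. s (\<rho> n))" for s
    by (auto simp: fun_eq_iff \<sigma>_def with_params_def)
  then have "P (\<lambda>n. s (\<rho> n)) \<longleftrightarrow> sat (with_params k e s) (rename \<sigma> p)" for s
    by (simp add: P sat_rename[OF inj])
  then show ?thesis by (rule definableI)
qed

lemma definable_term_var: "definable_term (\<lambda>s. s i)"
proof -
  have "s 0 = s (Suc i) \<longleftrightarrow> sat (with_params 0 undefined s) (Eq 0 (Suc i))" for s
    by (simp add: with_params_def)
  then show ?thesis unfolding definable_term_def by (rule definableI)
qed

lemma definable_term_const: "definable_term (\<lambda>s. c)"
proof -
  have "s 0 = c \<longleftrightarrow> sat (with_params 1 (\<lambda>_. c) s) (Eq 1 0)" for s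
    by (simp add: with_params_def)
  then show ?thesis unfolding definable_term_def by (rule definableI)
qed

lemma definable_ex:
  assumes "definable (\<lambda>s. R (\<lambda>n. s (Suc n)) (s 0))"
  shows "definable (\<lambda>s. \<exists>a. R s a)"
  using definable_not[OF definable_all[of "\<lambda>s a. \<not> R s a", OF definable_not[OF assms]]] by simp

lemma definable_disj: "definable P \<Longrightarrow> definable Q \<Longrightarrow> definable (\<lambda>s. P s \<or> Q s)"
  using definable_not[OF definable_conj[OF definable_not[of P] definable_not[of Q]]] by simp

lemma definable_imp: "definable P \<Longrightarrow> definable Q \<Longrightarrow> definable (\<lambda>s. P s \<longrightarrow> Q s)"
  unfolding imp_conv_disj by (intro definable_disj definable_not)

lemma definable_iff: "definable P \<Longrightarrow> definable Q \<Longrightarrow> definable (\<lambda>s. P s \<longleftrightarrow> Q s)"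
  unfolding iff_conv_conj_imp by (intro definable_conj definable_imp)

text \<open>
  The defining equation of \<open>T s\<close> is conjoined under an existential quantifier.
\<close>

lemma definable_at_term:
  assumes "definable_term T" "definable (\<lambda>s. Q (s 0) (\<lambda>n. s (Suc n)))"
  shows "definable (\<lambda>s. Q (T s) s)"
proof -
  have "definable (\<lambda>s. \<exists>a. a = T s \<and> Q a s)"
    by (intro definable_ex definable_conj assms(2) assms(1)[unfolded definable_term_def])
  then show ?thesis by simp
qed

lemma definable_term_shift:
  assumes "definable_term T"
  shows "definable_term (\<lambda>s. T (\<lambda>n. s (Suc n)))"
proof -
  have "inj (\<lambda>n. if n = 0 then 0 else Suc n)" by (auto simp: inj_def)
  from definable_rename[OF assms[unfolded definable_term_def] this]
  show ?thesis unfolding definable_term_def by simp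
qed

lemma definable_eq:
  assumes "definable_term T" "definable_term U"
  shows "definable (\<lambda>s. T s = U s)"
  by (rule definable_at_term[OF assms(1), of "\<lambda>a s. a = U s"])
    (use assms(2) in \<open>simp add: definable_term_def\<close>)

lemma definable_mem:
  assumes T: "definable_term T" and U: "definable_term U"
  shows "definable (\<lambda>s. T s \<epsilon> U s)"
proof (rule definable_at_term[OF T, of "\<lambda>a s. a \<epsilon> U s"],
    rule definable_at_term[OF definable_term_shift[OF U], of "\<lambda>b s. s 0 \<epsilon> b"])
  have "s (Suc 0) \<epsilon> s 0 \<longleftrightarrow> sat (with_params 0 undefined s) (Mem 1 0)" for s
    by (simp add: with_params_def)
  then show "definable (\<lambda>s. s (Suc 0) \<epsilon> s 0)"
    by (rule definableI)
qed

lemma definable_ball: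
  assumes "definable_term T" "definable (\<lambda>s. R (\<lambda>n. s (Suc n)) (s 0))"
  shows "definable (\<lambda>s. \<forall>x\<in>elts (T s). R s x)"
proof -
  have "definable (\<lambda>s. \<forall>x. x \<epsilon> T s \<longrightarrow> R s x)"
    by (intro definable_all definable_imp definable_mem assms definable_term_shift definable_term_var)
  then show ?thesis by simp
qed

lemma definable_bex:
  assumes "definable_term T" "definable (\<lambda>s. R (\<lambda>n. s (Suc n)) (s 0))"
  shows "definable (\<lambda>s. \<exists>x\<in>elts (T s). R s x)"
  using definable_not[OF definable_ball[OF assms(1), of "\<lambda>s x. \<not> R s x"]] definable_not[OF assms(2)]
  by simp

lemma definable_ex1:
  assumes "definable (\<lambda>s. R (\<lambda>n. s (Suc n)) (s 0))"
  shows "definable (\<lambda>s. \<exists>!a. R s a)"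
proof -
  \<comment> \<open>The quantified witness is at index \<open>0\<close>; the renaming skips \<open>a\<close> at index \<open>1\<close>.\<close>
  have "inj (\<lambda>n. case n of 0 \<Rightarrow> 0 | Suc n \<Rightarrow> Suc (Suc n))"
    by (auto simp: inj_def split: nat.splits)
  from definable_rename[OF assms this]
  have "definable (\<lambda>s. \<exists>a. R s a \<and> (\<forall>b. R s b \<longrightarrow> b = a))"
    by (intro definable_ex definable_all definable_conj definable_imp definable_eq definable_term_var assms)
       simp
  then show ?thesis by (simp add: Ex1_def)
qed

lemmas definable_intros =
  definable_not definable_conj definable_disj definable_imp definable_iff
  definable_ball definable_bex definable_all definable_ex definable_ex1
  definable_eq definable_mem
  definable_term_const definable_term_var

lemma definable_termI: "definable (\<lambda>s. s 0 = T (\<lambda>n. s (Suc n))) \<Longrightarrow> definable_term T"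
  by (simp add: definable_term_def)

text \<open>
  The value \<open>app f x\<close> is a definite description, arbitrary where it does not denote, and so
  \<open>app\<close> is definable only where it does. The variant \<open>ap\<close> has a definable default value and can be
  used in formulas; it agrees with \<open>app\<close> on the domain of a function.
\<close>

definition ap :: "'v \<Rightarrow> 'v \<Rightarrow> 'v" where
  "ap f x = (if \<exists>!y. opair x y \<epsilon> f then app f x else empty)"

lemma ap_eq: "is_fun f A B \<Longrightarrow> x \<epsilon> A \<Longrightarrow> ap f x = app f x"
  by (auto simp: ap_def is_fun_def)

end

section \<open>Sets, pairs and functions in a model of ZF\<close>

context ZF
begin

lemma mem_set_of:
  assumes "\<exists>z. \<forall>x. x \<epsilon> z \<longleftrightarrow> P x"
  shows "x \<epsilon> set_of P \<longleftrightarrow> P x"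
proof -
  have "\<exists>!z. \<forall>x. x \<epsilon> z \<longleftrightarrow> P x"
    using assms extensionality by (metis (no_types))
  from theI'[OF this] show ?thesis unfolding set_of_def by blast
qed

lemma definable_separation:
  assumes "definable (\<lambda>s. P (s 0))"
  shows "\<exists>z. \<forall>x. x \<epsilon> z \<longleftrightarrow> x \<epsilon> A \<and> P x"
proof -
  obtain k e p where p: "P (s 0) \<longleftrightarrow> sat (with_params k e s) p" for s
    by (rule definableE[OF assms(1)]) blast
  \<comment> \<open>The separation schema separates by the variable at place \<open>0\<close>, where the parameters begin.\<close>
  define \<sigma> where "\<sigma> = (\<lambda>i. if i = k then 0 else if i < k then Suc i else i)"
  have inj: "inj \<sigma>"
    by (auto simp: inj_def \<sigma>_def split: if_splits)
  define s' where "s' = (\<lambda>i. if i \<le> k then e (i - 1) else e 0)"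
  have "P x \<longleftrightarrow> sat (s'(0 := x)) (rename \<sigma> p)" for x
  proof -
    have "P x \<longleftrightarrow> sat (with_params k e (\<lambda>i. if i = 0 then x else e 0)) p"
      using p[of "\<lambda>i. if i = 0 then x else e 0"] by simp
    also have "with_params k e (\<lambda>i. if i = 0 then x else e 0) = (\<lambda>i. (s'(0 := x)) (\<sigma> i))"
      by (auto simp: with_params_def \<sigma>_def s'_def fun_eq_iff)
    finally show ?thesis by (simp add: sat_rename[OF inj])
  qed
  with separation[of A s' "rename \<sigma> p"] show ?thesis by simp
qed

lemma mem_set_of_definable:
  assumes "definable (\<lambda>s. P (s 0))" "\<And>x. P x \<Longrightarrow> x \<epsilon> A"
  shows "x \<epsilon> set_of P \<longleftrightarrow> P x"
  using definable_separation[OF assms(1), of A] assms(2) by (intro mem_set_of) blast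

lemma mem_upair: "x \<epsilon> upair a b \<longleftrightarrow> x = a \<or> x = b"
  unfolding upair_def using pairing by (rule mem_set_of)

lemma set_eqI: "(\<And>z. z \<epsilon> x \<longleftrightarrow> z \<epsilon> y) \<Longrightarrow> x = y"
  using extensionality by blast

lemma upair_eq_iff: "upair a b = upair c d \<longleftrightarrow> (a = c \<and> b = d) \<or> (a = d \<and> b = c)"
proof
  assume "upair a b = upair c d"
  then have "x = a \<or> x = b \<longleftrightarrow> x = c \<or> x = d" for x
    using mem_upair[of x a b] mem_upair[of x c d] by simp
  from this[of a] this[of b] this[of c] this[of d] show "(a = c \<and> b = d) \<or> (a = d \<and> b = c)"
    by metis
qed (auto intro: set_eqI simp: mem_upair)

lemma opair_inject [simp]: "opair a b = opair c d \<longleftrightarrow> a = c \<and> b = d"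
  unfolding opair_def by (auto simp: upair_eq_iff)

lemma not_mem_empty [simp]: "\<not> x \<epsilon> empty"
proof -
  have "\<exists>z. \<forall>x. x \<epsilon> z \<longleftrightarrow> False" using infinity by blast
  from mem_set_of[OF this] show ?thesis by (simp add: empty_def)
qed

lemma insert_exists: "\<exists>z. \<forall>x. x \<epsilon> z \<longleftrightarrow> x \<epsilon> A \<or> x = a"
proof -
  obtain z where "w \<epsilon> z \<longleftrightarrow> (\<exists>y. y \<epsilon> upair A (upair a a) \<and> w \<epsilon> y)" for w
    using union[of "upair A (upair a a)"] by blast
  then show ?thesis by (intro exI[of _ z]) (auto simp: mem_upair)
qed

lemma mem_succ [simp]: "x \<epsilon> succ n \<longleftrightarrow> x \<epsilon> n \<or> x = n"
  unfolding succ_def by (rule mem_set_of[OF insert_exists])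

lemma definable_term_upair:
  assumes "definable_term T" "definable_term U"
  shows "definable_term (\<lambda>s. upair (T s) (U s))"
proof (rule definable_termI)
  have "definable (\<lambda>s. \<forall>z. z \<epsilon> s 0 \<longleftrightarrow> z = T (\<lambda>n. s (Suc n)) \<or> z = U (\<lambda>n. s (Suc n)))"
    by (intro definable_intros assms[THEN definable_term_shift, THEN definable_term_shift])
  moreover have "y = upair a b \<longleftrightarrow> (\<forall>z. z \<epsilon> y \<longleftrightarrow> z = a \<or> z = b)" for y a b
    using mem_upair set_eqI by (metis (no_types))
  ultimately show "definable (\<lambda>s. s 0 = upair (T (\<lambda>n. s (Suc n))) (U (\<lambda>n. s (Suc n))))" by simp
qed

lemma definable_term_opair:
  assumes "definable_term T" "definable_term U"
  shows "definable_term (\<lambda>s. opair (T s) (U s))"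
  unfolding opair_def by (intro definable_term_upair assms)

lemma definable_term_succ:
  assumes "definable_term T"
  shows "definable_term (\<lambda>s. succ (T s))"
proof (rule definable_termI)
  have "definable (\<lambda>s. \<forall>z. z \<epsilon> s 0 \<longleftrightarrow> z \<epsilon> T (\<lambda>n. s (Suc n)) \<or> z = T (\<lambda>n. s (Suc n)))"
    by (intro definable_intros assms[THEN definable_term_shift, THEN definable_term_shift])
  moreover have "y = succ a \<longleftrightarrow> (\<forall>z. z \<epsilon> y \<longleftrightarrow> z \<epsilon> a \<or> z = a)" for y a
    using mem_succ set_eqI by (metis (no_types))
  ultimately show "definable (\<lambda>s. s 0 = succ (T (\<lambda>n. s (Suc n))))" by simp
qed

lemma definable_term_ap:
  assumes "definable_term T" "definable_term U"
  shows "definable_term (\<lambda>s. ap (T s) (U s))"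
proof (rule definable_termI)
  note sh = assms[THEN definable_term_shift]
  let ?P = "\<lambda>T U y. (\<exists>!y. opair U y \<epsilon> T) \<and> opair U y \<epsilon> T \<or> \<not> (\<exists>!y. opair U y \<epsilon> T) \<and> y = empty"
  have "definable (\<lambda>s. ?P (T (\<lambda>n. s (Suc n))) (U (\<lambda>n. s (Suc n))) (s 0))"
    by (intro definable_intros definable_term_opair sh sh[THEN definable_term_shift])
  moreover have "y = ap f x \<longleftrightarrow> ?P f x y" for y f x
  proof (cases "\<exists>!y. opair x y \<epsilon> f")
    case True
    then have "opair x y \<epsilon> f \<longleftrightarrow> y = app f x"
      unfolding app_def by (metis theI')
    with True show ?thesis unfolding ap_def by (simp only: if_True simp_thms)
  qed (auto simp: ap_def)
  ultimately show "definable (\<lambda>s. s 0 = ap (T (\<lambda>n. s (Suc n))) (U (\<lambda>n. s (Suc n))))" by simp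
qed

lemmas definability =
  definable_intros definable_term_opair definable_term_succ definable_term_ap

lemma mem_cart: "p \<epsilon> cart A B \<longleftrightarrow> (\<exists>a\<in>elts A. \<exists>b\<in>elts B. p = opair a b)"
proof -
  obtain U where "w \<epsilon> U \<longleftrightarrow> (\<exists>y. y \<epsilon> upair A B \<and> w \<epsilon> y)" for w
    using union[of "upair A B"] by blast
  then have U: "w \<epsilon> U \<longleftrightarrow> w \<epsilon> A \<or> w \<epsilon> B" for w
    using mem_upair by (metis (no_types))
  obtain P where P: "w \<epsilon> P \<longleftrightarrow> (\<forall>y. y \<epsilon> w \<longrightarrow> y \<epsilon> U)" for w
    using power_set[of U] by blast
  obtain Q where Q: "w \<epsilon> Q \<longleftrightarrow> (\<forall>y. y \<epsilon> w \<longrightarrow> y \<epsilon> P)" for w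
    using power_set[of P] by blast
  show ?thesis unfolding cart_def
  proof (rule mem_set_of_definable[where A = Q])
    show "definable (\<lambda>s. \<exists>a\<in>elts A. \<exists>b\<in>elts B. s 0 = opair a b)"
      by (intro definability)
    fix x assume "\<exists>a\<in>elts A. \<exists>b\<in>elts B. x = opair a b"
    then show "x \<epsilon> Q"
      by (auto simp: Q P U opair_def mem_upair)
  qed
qed

lemma opair_mem_cart [simp]: "opair a b \<epsilon> cart A B \<longleftrightarrow> a \<epsilon> A \<and> b \<epsilon> B"
  by (auto simp: mem_cart)

lemma app_mem:
  assumes "is_fun f A B" "x \<epsilon> A"
  shows "app f x \<epsilon> B" "opair x (app f x) \<epsilon> f"
proof -
  show *: "opair x (app f x) \<epsilon> f"
    using assms theI'[of "\<lambda>y. opair x y \<epsilon> f"] by (simp add: is_fun_def app_def)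
  then show "app f x \<epsilon> B" using assms by (auto simp: is_fun_def)
qed

lemma is_fun_subset:
  assumes "is_fun f A B" "elts B \<subseteq> elts C"
  shows "is_fun f A C"
proof -
  have "elts (cart A B) \<subseteq> elts (cart A C)" using assms(2) by (auto simp: mem_cart)
  then show ?thesis using assms(1) unfolding is_fun_def by (meson subset_trans)
qed

lemma definable_is_fun: "definable (\<lambda>s. is_fun (s 0) A B)"
  unfolding is_fun_def subset_eq mem_Collect_eq
  by (intro definability)

lemma mem_funspace: "f \<epsilon> funspace A B \<longleftrightarrow> is_fun f A B"
proof -
  obtain Q where Q: "w \<epsilon> Q \<longleftrightarrow> (\<forall>y. y \<epsilon> w \<longrightarrow> y \<epsilon> cart A B)" for w
    using power_set[of "cart A B"] by blast
  show ?thesis unfolding funspace_def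
    by (rule mem_set_of_definable[OF definable_is_fun, where A = Q]) (auto simp: Q is_fun_def)
qed

end

section \<open>The natural numbers of the model\<close>

context ZF
begin

lemma mem_omega: "n \<epsilon> omega \<longleftrightarrow> (\<forall>I. empty \<epsilon> I \<and> (\<forall>k\<in>elts I. succ k \<epsilon> I) \<longrightarrow> n \<epsilon> I)"
proof -
  obtain I where e: "\<exists>e. e \<epsilon> I \<and> (\<forall>w. \<not> w \<epsilon> e)"
    and s: "\<forall>x. x \<epsilon> I \<longrightarrow> (\<exists>y. y \<epsilon> I \<and> (\<forall>w. w \<epsilon> y \<longleftrightarrow> w \<epsilon> x \<or> w = x))"
    using infinity by blast
  have "e = empty" if "\<forall>w. \<not> w \<epsilon> e" for e
    using that by (intro set_eqI) simp
  then have "empty \<epsilon> I" using e by auto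
  moreover have "succ k \<epsilon> I" if k: "k \<epsilon> I" for k
  proof -
    obtain y where "y \<epsilon> I" "w \<epsilon> y \<longleftrightarrow> w \<epsilon> k \<or> w = k" for w using s k by blast
    moreover from this have "y = succ k" by (intro set_eqI) simp
    ultimately show ?thesis by simp
  qed
  ultimately show ?thesis unfolding omega_def
    by (intro mem_set_of_definable[where A = I] definability definable_term_succ) blast
qed

lemma empty_mem_omega [simp]: "empty \<epsilon> omega"
  by (simp add: mem_omega)

lemma succ_mem_omega [simp]: "n \<epsilon> omega \<Longrightarrow> succ n \<epsilon> omega"
  by (simp add: mem_omega)

text \<open>
  The natural numbers of the model may be non-standard. Induction over them is therefore available
  for definable predicates only.
\<close>

lemma omega_induct [consumes 1, case_names definable empty succ]:
  assumes n: "n \<epsilon> omega" and P: "definable (\<lambda>s. P (s 0))"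
    and base: "P empty" and step: "\<And>n. n \<epsilon> omega \<Longrightarrow> P n \<Longrightarrow> P (succ n)"
  shows "P n"
proof -
  obtain I where I: "x \<epsilon> I \<longleftrightarrow> x \<epsilon> omega \<and> P x" for x
    using definable_separation[of P omega, OF P] by blast
  have "n \<epsilon> I"
    using n[unfolded mem_omega, rule_format, of I] base step by (simp add: I)
  then show ?thesis by (simp add: I)
qed

lemma mem_omega_mem:
  assumes "n \<epsilon> omega"
  shows "m \<epsilon> n \<longrightarrow> m \<epsilon> omega"
  using assms
proof (induction n rule: omega_induct)
  case definable
  show ?case by (intro definability)
qed auto

lemma nat_transitive:
  assumes "n \<epsilon> omega" "k \<epsilon> m" "m \<epsilon> n"
  shows "k \<epsilon> n"
proof -
  have "\<forall>m\<in>elts n. \<forall>k\<in>elts m. k \<epsilon> n"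
    using assms(1)
  proof (induction n rule: omega_induct)
    case definable
    show ?case by (intro definability)
  qed auto
  then show ?thesis using assms(2,3) by blast
qed

lemma nat_le_refl [simp]: "nat_le n n"
  by (simp add: nat_le_def)

lemma mem_nat_le_trans: "k \<epsilon> m \<Longrightarrow> nat_le m n \<Longrightarrow> n \<epsilon> omega \<Longrightarrow> k \<epsilon> n"
  unfolding nat_le_def by (metis nat_transitive)

lemma nat_le_succ: "nat_le n (succ m) \<longleftrightarrow> nat_le n m \<or> n = succ m"
  by (auto simp: nat_le_def)

lemma empty_nat_le:
  assumes "n \<epsilon> omega"
  shows "nat_le empty n"
  using assms
proof (induction n rule: omega_induct)
  case definable
  show ?case unfolding nat_le_def by (intro definability)
qed (simp_all add: nat_le_succ)

lemma succ_nat_le: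
  assumes "m \<epsilon> omega"
  shows "n \<epsilon> m \<longrightarrow> nat_le (succ n) m"
  using assms
proof (induction m rule: omega_induct)
  case definable
  show ?case unfolding nat_le_def by (intro definability)
qed (auto simp: nat_le_succ)

lemma nat_le_linear:
  assumes m: "m \<epsilon> omega" and n: "n \<epsilon> omega"
  shows "nat_le m n \<or> nat_le n m"
  using m
proof (induction m rule: omega_induct)
  case definable
  show ?case unfolding nat_le_def by (intro definability)
next
  case empty
  show ?case by (simp add: empty_nat_le n)
next
  case (succ m)
  show ?case
  proof (cases "m \<epsilon> n")
    case True
    then show ?thesis using succ_nat_le[OF n] by blast
  next
    case False
    then have "nat_le n m" using succ.IH by (auto simp: nat_le_def)
    then show ?thesis by (simp add: nat_le_succ)
  qed
qed

lemma nat_le_upper: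
  assumes "m \<epsilon> omega" "n \<epsilon> omega"
  obtains k where "k \<epsilon> omega" "nat_le m k" "nat_le n k"
  using nat_le_linear[OF assms] assms nat_le_refl by blast

text \<open>
  A relation that is a set is definable, so steps can be composed by induction in the model. This
  does not hold for an arbitrary reflexive and transitive predicate of HOL.
\<close>

lemma chain_related:
  assumes f: "is_fun f omega X"
    and refl: "\<And>x. x \<epsilon> X \<Longrightarrow> opair x x \<epsilon> q"
    and trans: "\<And>x y z. x \<epsilon> X \<Longrightarrow> y \<epsilon> X \<Longrightarrow> z \<epsilon> X \<Longrightarrow> opair x y \<epsilon> q \<Longrightarrow> opair y z \<epsilon> q \<Longrightarrow> opair x z \<epsilon> q"
    and step: "\<And>n. n \<epsilon> omega \<Longrightarrow> opair (app f n) (app f (succ n)) \<epsilon> q"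
    and n: "n \<epsilon> omega" and m: "m \<epsilon> omega" and "nat_le n m"
  shows "opair (app f n) (app f m) \<epsilon> q"
proof -
  note ap = ap_eq[OF f] and val = app_mem(1)[OF f]
  have "nat_le n m \<longrightarrow> opair (ap f n) (ap f m) \<epsilon> q"
    using m
  proof (induction m rule: omega_induct)
    case definable
    show ?case unfolding nat_le_def by (intro definability)
  next
    case empty
    show ?case using n refl[OF val[of empty]] by (auto simp: nat_le_def ap)
  next
    case (succ m)
    note m' = succ_mem_omega[OF succ.hyps(1)]
    show ?case
    proof (cases "nat_le n m")
      case True
      then have "opair (app f n) (app f m) \<epsilon> q"
        using succ by (simp add: ap n)
      then have "opair (app f n) (app f (succ m)) \<epsilon> q"
        using step[OF succ.hyps(1)] trans val n m' succ.hyps(1) by blast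
      then show ?thesis by (simp add: ap n m')
    next
      case False
      then show ?thesis
        using refl[OF val[OF m']] by (auto simp: nat_le_succ ap m')
    qed
  qed
  then show ?thesis using assms(7) by (simp add: ap n m)
qed

text \<open>
  An \<open>\<epsilon>\<close>-minimal element of the set of all \<open>n\<close> with \<open>P n\<close> is given by foundation.
\<close>

lemma least_nat:
  assumes P: "definable (\<lambda>s. P (s 0))" and "n \<epsilon> omega" "P n"
  obtains m where "m \<epsilon> omega" "P m" "\<And>k. k \<epsilon> m \<Longrightarrow> \<not> P k"
proof -
  obtain S where S: "x \<epsilon> S \<longleftrightarrow> x \<epsilon> omega \<and> P x" for x
    using definable_separation[of P omega, OF P] by blast
  then obtain m where "m \<epsilon> S" "\<not> (\<exists>z. z \<epsilon> S \<and> z \<epsilon> m)"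
    using foundation[of S] assms(2,3) by blast
  then show ?thesis using that[of m] S mem_omega_mem[of m] by blast
qed

lemma relation_exists:
  assumes "definable (\<lambda>s. Q (s 0) (s 1))"
  obtains q where "is_rel q A" "\<And>x y. opair x y \<epsilon> q \<longleftrightarrow> x \<epsilon> A \<and> y \<epsilon> A \<and> Q x y"
proof -
  have "definable (\<lambda>s. \<exists>x\<in>elts A. \<exists>y\<in>elts A. s 0 = opair x y \<and> Q x y)"
  proof (intro definability)
    \<comment> \<open>The quantifier over \<open>y\<close> is the inner one, so \<open>y\<close> has index \<open>0\<close> and the indices are swapped.\<close>
    have "inj (case_nat (1::nat) (case_nat 0 (\<lambda>n. Suc (Suc n))))"
      by (auto simp: inj_def split: nat.splits)
    from definable_rename[OF assms this]
    show "definable (\<lambda>s. Q (s (Suc 0)) (s 0))" by simp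
  qed
  then obtain q where q: "p \<epsilon> q \<longleftrightarrow> p \<epsilon> cart A A \<and> (\<exists>x\<in>elts A. \<exists>y\<in>elts A. p = opair x y \<and> Q x y)" for p
    using definable_separation[of "\<lambda>p. \<exists>x\<in>elts A. \<exists>y\<in>elts A. p = opair x y \<and> Q x y" "cart A A"]
    by blast
  show ?thesis
  proof (rule that[of q])
    show "is_rel q A" unfolding is_rel_def using q by blast
    show "opair x y \<epsilon> q \<longleftrightarrow> x \<epsilon> A \<and> y \<epsilon> A \<and> Q x y" for x y
      unfolding q by auto
  qed
qed

text \<open>
  The form in which DC is used: a definable predicate on a set induces a relation that is a set.
\<close>

lemma dependent_choice:
  assumes "DC" and Q: "definable (\<lambda>s. Q (s 0) (s 1))"
    and "a \<epsilon> A" and ex: "\<And>x. x \<epsilon> A \<Longrightarrow> \<exists>y. y \<epsilon> A \<and> Q x y"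
  obtains f where "is_fun f omega A" "app f empty = a"
    "\<And>n. n \<epsilon> omega \<Longrightarrow> Q (app f n) (app f (succ n))"
proof -
  obtain q where q: "is_rel q A" "\<And>x y. opair x y \<epsilon> q \<longleftrightarrow> x \<epsilon> A \<and> y \<epsilon> A \<and> Q x y"
    using relation_exists[of Q A, OF Q] by blast
  have "elts A \<noteq> {} \<and> is_rel q A \<and> (\<forall>x\<in>elts A. \<exists>y\<in>elts A. opair x y \<epsilon> q) \<and> a \<epsilon> A"
    using assms(3) ex q by blast
  then show ?thesis
    using \<open>DC\<close>[unfolded DC_def] that q(2) by blast
qed

end

section \<open>The real numbers of the model\<close>

locale ZF_real_line = ZF mem + real_line mem reals add mul zero one ord pinf minf
  for mem :: "'v \<Rightarrow> 'v \<Rightarrow> bool"  (infix \<open>\<epsilon>\<close> 50)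
    and reals add mul zero one ord pinf minf :: 'v
begin

lemma add_real: "x \<epsilon> reals \<Longrightarrow> y \<epsilon> reals \<Longrightarrow> x \<oplus> y \<epsilon> reals"
  unfolding app2_def by (rule app_mem(1)[OF add_fun]) simp

lemma mul_real: "x \<epsilon> reals \<Longrightarrow> y \<epsilon> reals \<Longrightarrow> x \<otimes> y \<epsilon> reals"
  unfolding app2_def by (rule app_mem(1)[OF mul_fun]) simp

lemma le_real:
  assumes "x \<preceq> y"
  shows "x \<epsilon> reals" "y \<epsilon> reals"
  using assms ord_rel unfolding is_rel_def by (auto dest!: subsetD)

lemma add_le_add:
  assumes "a \<preceq> b" "c \<preceq> d"
  shows "a \<oplus> c \<preceq> b \<oplus> d"
proof -
  note reals = le_real[OF assms(1)] le_real[OF assms(2)]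
  have "a \<oplus> c \<preceq> b \<oplus> c" using assms reals by (intro add_mono)
  moreover have "b \<oplus> c \<preceq> b \<oplus> d"
    using add_mono[OF assms(2), of b] reals by (simp add: add_commute)
  ultimately show ?thesis by (rule ord_trans)
qed

lemma add_le_cancel:
  assumes "a \<oplus> c \<preceq> b \<oplus> c" "a \<epsilon> reals" "b \<epsilon> reals" "c \<epsilon> reals"
  shows "a \<preceq> b"
proof -
  obtain c' where c': "c' \<epsilon> reals" "c \<oplus> c' = zero" using add_inverse[OF assms(4)] by blast
  then show ?thesis
    using add_mono[OF assms(1) c'(1)] assms by (simp add: add_assoc add_zero)
qed

lemma add_cancel:
  assumes "a \<oplus> c = b \<oplus> c" "a \<epsilon> reals" "b \<epsilon> reals" "c \<epsilon> reals"
  shows "a = b"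
  using assms add_le_cancel[of a c b] add_le_cancel[of b c a]
    ord_refl[of "b \<oplus> c"] add_real ord_antisym by metis

lemma zero_add: "x \<epsilon> reals \<Longrightarrow> zero \<oplus> x = x"
  using add_zero[of x] add_commute[of x zero] zero_real by simp

lemma mul_zero:
  assumes "x \<epsilon> reals"
  shows "x \<otimes> zero = zero"
proof (rule add_cancel)
  show "x \<otimes> zero \<oplus> x \<otimes> zero = zero \<oplus> x \<otimes> zero"
    using distrib[of x zero zero] add_zero[OF zero_real] assms zero_real
    by (simp add: zero_add mul_real)
qed (use assms mul_real zero_real in auto)

lemma zero_le_one: "zero \<preceq> one"
proof (rule ccontr)
  assume "\<not> zero \<preceq> one"
  then have le: "one \<preceq> zero" using ord_total zero_real one_real by blast
  obtain m where m: "m \<epsilon> reals" "one \<oplus> m = zero" using add_inverse[OF one_real] by blast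
  have "zero \<preceq> m" using add_mono[OF le m(1)] m by (simp add: zero_add)
  then have "zero \<preceq> m \<otimes> m" by (intro mul_nonneg)
  \<comment> \<open>Here \<open>m\<close> is the negative of \<open>one\<close>, and its square is \<open>one\<close>.\<close>
  moreover have "m \<otimes> m = one"
  proof (rule add_cancel)
    have "m \<otimes> (one \<oplus> m) = m \<otimes> one \<oplus> m \<otimes> m" using m one_real by (intro distrib)
    then have "m \<oplus> m \<otimes> m = zero" using m mul_zero[OF m(1)] by (simp add: mul_one)
    then show "m \<otimes> m \<oplus> m = one \<oplus> m" using m by (simp add: add_commute mul_real)
  qed (use m mul_real one_real in auto)
  ultimately show False using \<open>\<not> zero \<preceq> one\<close> by simp
qed

definition positive :: "'v \<Rightarrow> bool" where
  "positive e \<longleftrightarrow> zero \<preceq> e \<and> e \<noteq> zero"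

lemma positive_real: "positive e \<Longrightarrow> e \<epsilon> reals"
  unfolding positive_def using le_real by blast

text \<open>
  Half of \<open>e\<close> is \<open>e\<close> times the inverse of \<open>one \<oplus> one\<close>, which is nonzero because \<open>one\<close> is positive.
\<close>

lemma positive_half:
  assumes "positive e"
  obtains h where "positive h" "h \<oplus> h = e"
proof -
  let ?two = "one \<oplus> one"
  have e: "e \<epsilon> reals" "zero \<preceq> e" "e \<noteq> zero"
    using assms positive_real unfolding positive_def by auto
  have two: "?two \<epsilon> reals" using one_real by (intro add_real)
  have two0: "?two \<noteq> zero"
  proof
    assume "?two = zero"
    then have "one \<preceq> zero"
      using add_mono[OF zero_le_one one_real] by (simp add: zero_add one_real)
    then show False using zero_le_one zero_neq_one ord_antisym by blast
  qed
  obtain k where k: "k \<epsilon> reals" "?two \<otimes> k = one" using mul_inverse[OF two two0] by blast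
  have kk: "k \<oplus> k = one"
  proof -
    have "k \<otimes> ?two = k \<otimes> one \<oplus> k \<otimes> one" using k one_real by (intro distrib)
    then show ?thesis using k two by (simp add: mul_one mul_commute)
  qed
  have k0: "zero \<preceq> k"
  proof (rule ccontr)
    assume "\<not> zero \<preceq> k"
    then have "k \<preceq> zero" using ord_total zero_real k(1) by blast
    then have "one \<preceq> zero"
      using add_le_add[of k zero k zero] by (simp add: kk add_zero zero_real)
    then show False using zero_le_one zero_neq_one ord_antisym by blast
  qed
  have "e \<otimes> k \<oplus> e \<otimes> k = e"
    using distrib[OF e(1) k(1) k(1)] e by (simp add: kk mul_one)
  moreover from this have "positive (e \<otimes> k)"
    unfolding positive_def using mul_nonneg[OF e(2) k0] e add_zero[OF zero_real] by auto
  ultimately show ?thesis using that by blast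
qed

lemma not_le: "a \<epsilon> reals \<Longrightarrow> b \<epsilon> reals \<Longrightarrow> \<not> a \<preceq> b \<longleftrightarrow> b \<preceq> a \<and> a \<noteq> b"
  using ord_total ord_antisym ord_refl by blast

lemma positive_diff:
  assumes "b \<preceq> a" "a \<noteq> b"
  obtains e where "positive e" "b \<oplus> e = a"
proof -
  note r = le_real[OF assms(1)]
  obtain b' where b': "b' \<epsilon> reals" "b \<oplus> b' = zero" using add_inverse[OF r(1)] by blast
  have eq: "b \<oplus> (b' \<oplus> a) = a"
    using r b' add_assoc[of b b' a] by (simp add: zero_add)
  moreover have "zero \<preceq> b' \<oplus> a"
    using add_mono[OF assms(1) b'(1)] r b' by (simp add: add_commute)
  moreover have "b' \<oplus> a \<noteq> zero"
  proof
    assume "b' \<oplus> a = zero"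
    then show False using eq assms(2) add_zero[OF r(1)] by simp
  qed
  ultimately show ?thesis using that unfolding positive_def by blast
qed

text \<open>
  Otherwise half of the positive difference of \<open>a\<close> and \<open>b\<close> would be a counterexample.
\<close>

lemma le_if_le_add_positive:
  assumes "a \<epsilon> reals" "b \<epsilon> reals" "\<And>e. positive e \<Longrightarrow> a \<preceq> b \<oplus> e"
  shows "a \<preceq> b"
proof (rule ccontr)
  assume "\<not> a \<preceq> b"
  then have "b \<preceq> a" "a \<noteq> b" using not_le assms by auto
  then obtain e where e: "positive e" "b \<oplus> e = a" by (rule positive_diff)
  obtain h where h: "positive h" "h \<oplus> h = e" using e(1) by (rule positive_half)
  note hr = positive_real[OF h(1)]
  have "(b \<oplus> h) \<oplus> h = a" using e h hr assms by (simp add: add_assoc)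
  then have "h \<oplus> (b \<oplus> h) \<preceq> zero \<oplus> (b \<oplus> h)"
    using assms(3)[OF h(1)] hr assms(2) by (simp add: add_commute[of h] add_real zero_add)
  then have "h \<preceq> zero"
    by (rule add_le_cancel) (use hr assms(2) add_real zero_real in auto)
  then show False using h(1) ord_antisym unfolding positive_def by blast
qed

lemma diff_real:
  assumes "a \<epsilon> reals" "b \<epsilon> reals"
  shows "a \<ominus> b \<epsilon> reals" "(a \<ominus> b) \<oplus> b = a"
proof -
  obtain b' where b': "b' \<epsilon> reals" "b \<oplus> b' = zero" using add_inverse[OF assms(2)] by blast
  have "(a \<oplus> b') \<oplus> b = a"
    using assms b' by (simp add: add_assoc add_commute[of b'] add_zero)
  then have "\<exists>!c. c \<epsilon> reals \<and> c \<oplus> b = a"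
    using assms b' add_real add_cancel by metis
  moreover have "b \<noteq> pinf" using assms pinf_not_real by blast
  ultimately show "a \<ominus> b \<epsilon> reals" "(a \<ominus> b) \<oplus> b = a"
    using theI'[of "\<lambda>c. c \<epsilon> reals \<and> c \<oplus> b = a"] by (simp_all add: ext_diff_def)
qed

lemma le_diff_iff:
  assumes "a \<epsilon> reals" "b \<epsilon> reals" "c \<epsilon> reals"
  shows "c \<preceq> a \<ominus> b \<longleftrightarrow> c \<oplus> b \<preceq> a"
  using add_mono[of c "a \<ominus> b" b] add_le_cancel[of c b "a \<ominus> b"] assms
  by (auto simp: diff_real)

lemma mem_ext_reals: "x \<epsilon> ext_reals \<longleftrightarrow> x \<epsilon> reals \<or> x = pinf \<or> x = minf"
proof -
  obtain B where B: "x \<epsilon> B \<longleftrightarrow> x \<epsilon> reals \<or> x = pinf" for x using insert_exists[of reals pinf] by blast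
  obtain C where "x \<epsilon> C \<longleftrightarrow> x \<epsilon> B \<or> x = minf" for x using insert_exists[of B minf] by blast
  then have "\<exists>z. \<forall>x. x \<epsilon> z \<longleftrightarrow> x \<epsilon> reals \<or> x = pinf \<or> x = minf" using B by auto
  then show ?thesis unfolding ext_reals_def by (rule mem_set_of)
qed

lemma mem_reals_pinf: "x \<epsilon> reals_pinf \<longleftrightarrow> x \<epsilon> reals \<or> x = pinf"
  unfolding reals_pinf_def by (rule mem_set_of[OF insert_exists])

lemma ext_le_real: "a \<epsilon> reals \<Longrightarrow> b \<epsilon> reals \<Longrightarrow> a \<sqsubseteq> b \<longleftrightarrow> a \<preceq> b"
  unfolding ext_le_def using pinf_not_real minf_not_real by blast

lemma ext_le_trans: "a \<sqsubseteq> b \<Longrightarrow> b \<sqsubseteq> c \<Longrightarrow> a \<sqsubseteq> c"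
  unfolding ext_le_def using ord_trans pinf_neq_minf pinf_not_real minf_not_real by metis

lemma ext_le_antisym: "a \<sqsubseteq> b \<Longrightarrow> b \<sqsubseteq> a \<Longrightarrow> a = b"
  unfolding ext_le_def using ord_antisym pinf_neq_minf pinf_not_real minf_not_real by metis

lemma ext_less_pinf: "a \<epsilon> reals_pinf \<Longrightarrow> a \<sqsubset> pinf \<longleftrightarrow> a \<epsilon> reals"
  unfolding ext_less_def ext_le_def mem_reals_pinf using pinf_not_real by blast

lemma ext_less_zero: "zero \<sqsubset> e \<Longrightarrow> e \<epsilon> reals \<Longrightarrow> positive e"
  unfolding ext_less_def positive_def using ext_le_real zero_real by auto

lemma positive_ext_less: "positive e \<Longrightarrow> zero \<sqsubset> e"
  unfolding ext_less_def positive_def using ext_le_real zero_real le_real by blast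

lemma definable_ext_le:
  assumes "definable_term T" "definable_term U"
  shows "definable (\<lambda>s. T s \<sqsubseteq> U s)"
  unfolding ext_le_def by (intro definability assms)

text \<open>
  Characterizations of \<open>ext_sup\<close> and \<open>ext_inf\<close> that are meaningful without existence of the bound,
  unlike the definite descriptions.
\<close>

definition is_lub :: "'v \<Rightarrow> ('v \<Rightarrow> bool) \<Rightarrow> bool" where
  "is_lub m P \<longleftrightarrow> m \<epsilon> ext_reals \<and> (\<forall>a. P a \<longrightarrow> a \<sqsubseteq> m) \<and>
     (\<forall>u\<in>elts ext_reals. (\<forall>a. P a \<longrightarrow> a \<sqsubseteq> u) \<longrightarrow> m \<sqsubseteq> u)"

definition is_glb :: "'v \<Rightarrow> ('v \<Rightarrow> bool) \<Rightarrow> bool" where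
  "is_glb m P \<longleftrightarrow> m \<epsilon> ext_reals \<and> (\<forall>a. P a \<longrightarrow> m \<sqsubseteq> a) \<and>
     (\<forall>l\<in>elts ext_reals. (\<forall>a. P a \<longrightarrow> l \<sqsubseteq> a) \<longrightarrow> l \<sqsubseteq> m)"

text \<open>
  If a real number bounds \<open>A\<close>, the supremum is that of the real members given by Dedekind
  completeness, or \<open>minf\<close> if there are no real members; otherwise it is \<open>pinf\<close>.
\<close>

lemma lub_exists:
  assumes A: "\<And>a. a \<epsilon> A \<Longrightarrow> a \<epsilon> ext_reals"
  shows "\<exists>m. is_lub m (\<lambda>a. a \<epsilon> A)"
proof -
  obtain S where S: "x \<epsilon> S \<longleftrightarrow> x \<epsilon> A \<and> x \<epsilon> reals" for x
    using definable_separation[of "\<lambda>x. x \<epsilon> reals" A] definable_mem[OF definable_term_var definable_term_const]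
    by blast
  show ?thesis
  proof (cases "\<exists>u\<in>elts reals. \<forall>a\<in>elts A. a \<sqsubseteq> u")
    case True
    then obtain u where u: "u \<epsilon> reals" and le_u: "\<And>a. a \<epsilon> A \<Longrightarrow> a \<sqsubseteq> u" by blast
    have S_or_minf: "a \<epsilon> S \<or> a = minf" if "a \<epsilon> A" for a
      using A[OF that] le_u[OF that] u that pinf_not_real pinf_neq_minf
      unfolding S mem_ext_reals ext_le_def by blast
    show ?thesis
    proof (cases "elts S = {}")
      case True
      then have "a = minf" if "a \<epsilon> A" for a using S_or_minf[OF that] by blast
      then have "is_lub minf (\<lambda>a. a \<epsilon> A)"
        unfolding is_lub_def mem_ext_reals ext_le_def by blast
      then show ?thesis by blast
    next
      case False
      have "x \<preceq> u" if "x \<epsilon> S" for x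
        using le_u[of x] that u by (simp add: S ext_le_real)
      then obtain b where b: "b \<epsilon> reals" "\<forall>x\<in>elts S. x \<preceq> b"
        and least: "\<forall>c\<in>elts reals. (\<forall>x\<in>elts S. x \<preceq> c) \<longrightarrow> b \<preceq> c"
        using dedekind_complete[of S] False S u by blast
      have "a \<sqsubseteq> b" if "a \<epsilon> A" for a
        using S_or_minf[OF that] b S unfolding ext_le_def by blast
      moreover have "b \<sqsubseteq> v" if v: "v \<epsilon> ext_reals" and ub: "\<forall>a. a \<epsilon> A \<longrightarrow> a \<sqsubseteq> v" for v
      proof -
        obtain x where "x \<epsilon> S" using False by blast
        then have "v \<noteq> minf"
          using ub minf_not_real pinf_neq_minf unfolding S ext_le_def by blast
        moreover have "b \<sqsubseteq> v" if "v \<epsilon> reals"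
          using least ub that b(1) S ext_le_real by blast
        ultimately show ?thesis using v unfolding mem_ext_reals ext_le_def by blast
      qed
      ultimately show ?thesis using b(1) unfolding is_lub_def mem_ext_reals by blast
    qed
  next
    case False
    have "pinf \<sqsubseteq> v" if v: "v \<epsilon> ext_reals" and ub: "\<forall>a. a \<epsilon> A \<longrightarrow> a \<sqsubseteq> v" for v
    proof -
      have "v \<noteq> minf"
      proof
        assume "v = minf"
        then have "a \<sqsubseteq> zero" if "a \<epsilon> A" for a
          using ub that ext_le_trans[of a minf zero] unfolding ext_le_def by blast
        then show False using False zero_real by blast
      qed
      then show ?thesis using v ub False unfolding mem_ext_reals ext_le_def by blast
    qed
    then have "is_lub pinf (\<lambda>a. a \<epsilon> A)"
      unfolding is_lub_def mem_ext_reals ext_le_def by blast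
    then show ?thesis by blast
  qed
qed

text \<open>
  The infimum is the supremum of the set of all lower bounds.
\<close>

lemma glb_exists:
  assumes A: "\<And>a. a \<epsilon> A \<Longrightarrow> a \<epsilon> ext_reals"
  shows "\<exists>m. is_glb m (\<lambda>a. a \<epsilon> A)"
proof -
  have "definable (\<lambda>s. \<forall>a\<in>elts A. s 0 \<sqsubseteq> a)"
    by (intro definability definable_ext_le)
  then obtain L where L: "x \<epsilon> L \<longleftrightarrow> x \<epsilon> ext_reals \<and> (\<forall>a\<in>elts A. x \<sqsubseteq> a)" for x
    using definable_separation[of "\<lambda>x. \<forall>a\<in>elts A. x \<sqsubseteq> a" ext_reals] by blast
  obtain m where "is_lub m (\<lambda>a. a \<epsilon> L)" using lub_exists[of L] L by blast
  then have "is_glb m (\<lambda>a. a \<epsilon> A)"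
    unfolding is_lub_def is_glb_def L using A by blast
  then show ?thesis by blast
qed

lemma is_lub_ext_sup:
  assumes "\<And>a. a \<epsilon> A \<Longrightarrow> a \<epsilon> ext_reals"
  shows "is_lub (ext_sup A) (\<lambda>a. a \<epsilon> A)"
proof -
  have "\<exists>!m. is_lub m (\<lambda>a. a \<epsilon> A)"
    using lub_exists[of A] assms ext_le_antisym unfolding is_lub_def by blast
  from theI'[OF this] show ?thesis by (simp add: is_lub_def ext_sup_def)
qed

lemma is_glb_ext_inf:
  assumes "\<And>a. a \<epsilon> A \<Longrightarrow> a \<epsilon> ext_reals"
  shows "is_glb (ext_inf A) (\<lambda>a. a \<epsilon> A)"
proof -
  have "\<exists>!m. is_glb m (\<lambda>a. a \<epsilon> A)"
    using glb_exists[of A] assms ext_le_antisym unfolding is_glb_def by blast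
  from theI'[OF this] show ?thesis by (simp add: is_glb_def ext_inf_def)
qed

section \<open>Relations between the classes of functions\<close>

lemma range_inf_le:
  assumes \<phi>: "is_fun \<phi> X reals_pinf" and x: "x \<epsilon> X"
  shows "range_inf X \<phi> \<sqsubseteq> app \<phi> x"
proof -
  have eq: "(\<lambda>a. \<exists>x\<in>elts X. a = app \<phi> x) = (\<lambda>a. \<exists>x\<in>elts X. a = ap \<phi> x)"
    using ap_eq[OF \<phi>] by simp
  define R where "R = set_of (\<lambda>a. \<exists>x\<in>elts X. a = app \<phi> x)"
  have R: "a \<epsilon> R \<longleftrightarrow> (\<exists>x\<in>elts X. a = app \<phi> x)" for a
    unfolding R_def
  proof (rule mem_set_of_definable[where A = reals_pinf])
    show "definable (\<lambda>s. \<exists>x\<in>elts X. s 0 = app \<phi> x)"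
      using fun_cong[OF eq] by simp (intro definability)
  qed (use app_mem(1)[OF \<phi>] in auto)
  have "is_glb (range_inf X \<phi>) (\<lambda>a. a \<epsilon> R)"
    unfolding range_inf_def R_def[symmetric]
    by (rule is_glb_ext_inf) (use app_mem(1)[OF \<phi>] in \<open>auto simp: R mem_ext_reals mem_reals_pinf\<close>)
  then show ?thesis
    using x R unfolding is_glb_def by blast
qed

lemma in_P4_imp_in_P3: "in_P P4 X \<phi> \<Longrightarrow> in_P P3 X \<phi>"
  using zero_real minf_not_real pinf_neq_minf unfolding in_P.simps ext_less_def ext_le_def by metis

lemma in_L2_imp_in_L1: "in_L L2 X r D \<phi> \<Longrightarrow> in_L L1 X r D \<phi>"
  unfolding in_L.simps by blast

text \<open>
  For a descending sequence of values, every tail has an infimum below each value: the tail from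
  \<open>k\<close> contains a later value. That the tails and the collection of their infima are sets of the model
  is the main point.
\<close>

lemma liminf_le_if_descending:
  assumes \<phi>: "is_fun \<phi> X reals_pinf" and f: "is_fun f omega X"
    and desc: "descending_along \<phi> f" and n: "n \<epsilon> omega"
  shows "liminf_along \<phi> f \<sqsubseteq> app \<phi> (app f n)"
proof -
  define g where "g m = app \<phi> (app f m)" for m
  define tail where "tail n = set_of (\<lambda>b. \<exists>m\<in>elts omega. nat_le n m \<and> b = g m)" for n
  have g: "g m = ap \<phi> (ap f m)" if "m \<epsilon> omega" for m
    using ap_eq[OF \<phi>] ap_eq[OF f] app_mem(1)[OF f] that by (simp add: g_def)
  have g_mem: "g m \<epsilon> reals_pinf" if "m \<epsilon> omega" for m
    using app_mem(1)[OF \<phi>] app_mem(1)[OF f] that by (simp add: g_def)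
  then have g_ext: "g m \<epsilon> ext_reals" if "m \<epsilon> omega" for m
    using that unfolding mem_ext_reals mem_reals_pinf by blast
  have tail: "b \<epsilon> tail n \<longleftrightarrow> (\<exists>m\<in>elts omega. nat_le n m \<and> b = g m)" for b n
    unfolding tail_def
  proof (rule mem_set_of_definable[where A = reals_pinf])
    have "definable (\<lambda>s. \<exists>m\<in>elts omega. nat_le n m \<and> s 0 = ap \<phi> (ap f m))"
      unfolding nat_le_def by (intro definability)
    then show "definable (\<lambda>s. \<exists>m\<in>elts omega. nat_le n m \<and> s 0 = g m)"
      by (simp add: g cong: conj_cong)
  qed (use g_mem in auto)
  have glb: "is_glb (ext_inf (tail n)) (\<lambda>b. b \<epsilon> tail n)" for n
    by (rule is_glb_ext_inf) (use g_ext in \<open>auto simp: tail\<close>)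
  then have inf_ext: "ext_inf (tail n) \<epsilon> ext_reals" for n
    unfolding is_glb_def by blast
  have inf_eq: "a = ext_inf (tail n) \<longleftrightarrow> is_glb a (\<lambda>b. b \<epsilon> tail n)" for a n
    using glb[of n] ext_le_antisym unfolding is_glb_def by blast
  have all_tail: "(\<forall>b. b \<epsilon> tail n \<longrightarrow> Q b) \<longleftrightarrow>
      (\<forall>m\<in>elts omega. nat_le n m \<longrightarrow> Q (ap \<phi> (ap f m)))" for Q n
    unfolding tail using g by auto
  \<comment> \<open>A formula for the predicate that \<open>a\<close> is the infimum of the tail from \<open>n\<close>, in which the tail itself
    does not occur.\<close>
  have glb_iff: "is_glb a (\<lambda>b. b \<epsilon> tail n) \<longleftrightarrow> a \<epsilon> ext_reals \<and>
      (\<forall>m\<in>elts omega. nat_le n m \<longrightarrow> a \<sqsubseteq> ap \<phi> (ap f m)) \<and>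
      (\<forall>l\<in>elts ext_reals. (\<forall>m\<in>elts omega. nat_le n m \<longrightarrow> l \<sqsubseteq> ap \<phi> (ap f m)) \<longrightarrow> l \<sqsubseteq> a)" for a n
    unfolding is_glb_def all_tail ..
  define infs where "infs = set_of (\<lambda>a. \<exists>n\<in>elts omega. a = ext_inf (tail n))"
  have infs: "a \<epsilon> infs \<longleftrightarrow> (\<exists>n\<in>elts omega. a = ext_inf (tail n))" for a
    unfolding infs_def
  proof (rule mem_set_of_definable[where A = ext_reals])
    show "definable (\<lambda>s. \<exists>n\<in>elts omega. s 0 = ext_inf (tail n))"
      unfolding inf_eq glb_iff nat_le_def by (intro definability definable_ext_le)
  qed (use inf_ext in blast)
  have "liminf_along \<phi> f = ext_sup infs"
    unfolding liminf_along_def infs_def tail_def g_def ..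
  moreover have "is_lub (ext_sup infs) (\<lambda>a. a \<epsilon> infs)"
    proof (rule is_lub_ext_sup)
    fix a assume "a \<epsilon> infs"
    then obtain n where "a = ext_inf (tail n)" using infs[of a] by blast
    then show "a \<epsilon> ext_reals" by (simp only: inf_ext)
  qed
  moreover have "a \<sqsubseteq> g n" if a: "a \<epsilon> infs" for a
  proof -
    obtain k where k: "k \<epsilon> omega" "a = ext_inf (tail k)" using a infs[of a] by blast
    obtain m where m: "m \<epsilon> omega" "nat_le k m" "nat_le n m" using nat_le_upper[OF k(1) n] by blast
    have "g m \<epsilon> tail k" using m tail[of "g m" k] by blast
    then have "a \<sqsubseteq> g m" using glb[of k] unfolding k(2) is_glb_def by blast
    moreover have "g m \<sqsubseteq> g n" using desc m n unfolding descending_along_def g_def by blast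
    ultimately show ?thesis by (rule ext_le_trans)
  qed
  ultimately have "liminf_along \<phi> f \<sqsubseteq> g n"
    using g_ext[OF n] unfolding is_lub_def by simp
  then show ?thesis by (simp only: g_def)
qed

lemma in_L3_imp_in_L2:
  assumes "is_fun \<phi> X reals_pinf" "in_L L3 X r D \<phi>"
  shows "in_L L2 X r D \<phi>"
  using assms liminf_le_if_descending[OF assms(1)] ext_le_trans unfolding in_L.simps by blast

section \<open>The variational principle\<close>

text \<open>
  DC yields a sequence in which every term is half of the term before, starting with \<open>one\<close>. The
  infimum \<open>b\<close> of the terms satisfies \<open>b \<oplus> b \<preceq> b\<close>, so it is not positive.
\<close>

lemma null_sequence:
  assumes "DC"
  obtains \<eta> where "is_fun \<eta> omega reals" "\<And>n. n \<epsilon> omega \<Longrightarrow> positive (app \<eta> n)"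
    "\<And>n m. n \<epsilon> omega \<Longrightarrow> m \<epsilon> omega \<Longrightarrow> nat_le n m \<Longrightarrow> app \<eta> m \<preceq> app \<eta> n"
    "\<And>e. positive e \<Longrightarrow> \<exists>n\<in>elts omega. \<not> e \<preceq> app \<eta> n"
proof -
  obtain P where P: "x \<epsilon> P \<longleftrightarrow> positive x" for x
  proof -
    have "definable (\<lambda>s. positive (s 0))"
      unfolding positive_def by (intro definability)
    from definable_separation[of positive, OF this, of reals] show ?thesis
      using that positive_real by blast
  qed
  have one: "one \<epsilon> P" using zero_le_one zero_neq_one by (auto simp: P positive_def)
  have "definable (\<lambda>s. ap add (opair (s 1) (s 1)) = s 0)"
    by (intro definability)
  moreover have ap_add: "ap add (opair x x) = x \<oplus> x" if "x \<epsilon> reals" for x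
    unfolding app2_def using ap_eq[OF add_fun, of "opair x x"] that by simp
  moreover have "\<exists>y. y \<epsilon> P \<and> ap add (opair y y) = x" if "x \<epsilon> P" for x
  proof -
    obtain h where "positive h" "h \<oplus> h = x" using positive_half[of x] \<open>x \<epsilon> P\<close> P by blast
    then show ?thesis using ap_add P positive_real by auto
  qed
  ultimately obtain \<eta> where \<eta>: "is_fun \<eta> omega P"
    and step: "\<And>n. n \<epsilon> omega \<Longrightarrow> ap add (opair (app \<eta> (succ n)) (app \<eta> (succ n))) = app \<eta> n"
    using dependent_choice[OF \<open>DC\<close>, of "\<lambda>x y. ap add (opair y y) = x" one P] one by blast
  have seq: "is_fun \<eta> omega reals"
    using \<eta> P positive_real by (blast intro: is_fun_subset)
  have pos: "positive (app \<eta> n)" if "n \<epsilon> omega" for n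
    using app_mem(1)[OF \<eta> that] P by blast
  have half: "app \<eta> (succ n) \<oplus> app \<eta> (succ n) = app \<eta> n" if "n \<epsilon> omega" for n
    using step[OF that] ap_add[OF positive_real[OF pos[OF succ_mem_omega[OF that]]]] by simp
  have "definable (\<lambda>s. opair (s 1) (s 0) \<epsilon> ord)" by (intro definability)
  note rel = relation_exists[of "\<lambda>x y. y \<preceq> x" reals, OF this]
  obtain q where "is_rel q reals"
    and q: "\<And>x y. opair x y \<epsilon> q \<longleftrightarrow> x \<epsilon> reals \<and> y \<epsilon> reals \<and> y \<preceq> x"
    by (rule rel) (rule that)
  have q_step: "opair (app \<eta> n) (app \<eta> (succ n)) \<epsilon> q" if n: "n \<epsilon> omega" for n
  proof -
    let ?h = "app \<eta> (succ n)"
    have h: "positive ?h" "?h \<epsilon> reals" using pos positive_real succ_mem_omega[OF n] by auto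
    have "zero \<oplus> ?h \<preceq> ?h \<oplus> ?h" using h unfolding positive_def by (intro add_mono) auto
    then show ?thesis using half[OF n] h le_real unfolding q by (simp add: zero_add)
  qed
  have mono: "app \<eta> m \<preceq> app \<eta> n" if "n \<epsilon> omega" "m \<epsilon> omega" "nat_le n m" for n m
  proof -
    have "opair (app \<eta> n) (app \<eta> m) \<epsilon> q"
      by (rule chain_related[OF seq _ _ q_step that]) (auto simp: q intro: ord_refl ord_trans)
    then show ?thesis using q by blast
  qed
  have small: "\<exists>n\<in>elts omega. \<not> e \<preceq> app \<eta> n" if e: "positive e" for e
  proof (rule ccontr)
    assume "\<not> (\<exists>n\<in>elts omega. \<not> e \<preceq> app \<eta> n)"
    then have lower: "e \<preceq> app \<eta> n" if "n \<epsilon> omega" for n using that by blast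
    have "definable (\<lambda>s. \<forall>n\<in>elts omega. opair (s 0) (ap \<eta> n) \<epsilon> ord)" by (intro definability)
    then obtain L where "x \<epsilon> L \<longleftrightarrow> x \<epsilon> reals \<and> (\<forall>n\<in>elts omega. x \<preceq> ap \<eta> n)" for x
      using definable_separation[of "\<lambda>x. \<forall>n\<in>elts omega. x \<preceq> ap \<eta> n" reals] by blast
    then have L: "x \<epsilon> L \<longleftrightarrow> x \<epsilon> reals \<and> (\<forall>n\<in>elts omega. x \<preceq> app \<eta> n)" for x
      using ap_eq[OF seq] by auto
    have "e \<epsilon> L" using lower positive_real[OF e] L by blast
    moreover have "\<forall>x\<in>elts L. x \<preceq> app \<eta> empty" using L by simp
    ultimately obtain b where b: "b \<epsilon> reals" and ub: "\<forall>x\<in>elts L. x \<preceq> b"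
      and least: "\<forall>c\<in>elts reals. (\<forall>x\<in>elts L. x \<preceq> c) \<longrightarrow> b \<preceq> c"
      using dedekind_complete[of L] L app_mem(1)[OF seq empty_mem_omega] by blast
    have b_le: "b \<preceq> app \<eta> n" if "n \<epsilon> omega" for n
      using least app_mem(1)[OF seq that] L that by blast
    have "b \<oplus> b \<preceq> app \<eta> n" if n: "n \<epsilon> omega" for n
      using add_le_add[OF b_le b_le, of "succ n" "succ n"] n by (simp add: half)
    then have "b \<oplus> b \<epsilon> L" using b add_real unfolding L by blast
    then have "b \<oplus> b \<preceq> zero \<oplus> b" using ub b by (simp add: zero_add)
    then have "b \<preceq> zero" using b zero_real by (blast intro: add_le_cancel)
    moreover have "e \<preceq> b" using \<open>e \<epsilon> L\<close> ub by blast
    ultimately show False using e ord_trans ord_antisym unfolding positive_def by blast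
  qed
  show ?thesis using that[OF seq pos mono small] .
qed

end

locale variational_problem = ZF_real_line mem reals add mul zero one ord pinf minf
  for mem :: "'v \<Rightarrow> 'v \<Rightarrow> bool"  (infix \<open>\<epsilon>\<close> 50)
    and reals add mul zero one ord pinf minf :: 'v +
  fixes X r D \<Phi> :: 'v
  assumes order: "quasi_order X r"
    and family: "semimetric_family X D"
    and suff: "sufficient X D"
    and strongly_complete: "strongly_complete X r D"
    and Phi_fun: "is_fun \<Phi> omega (funspace X reals_pinf)"
    and Dom_nonempty: "elts (Dom_family X \<Phi>) \<noteq> {}"
    and P3: "\<And>i. i \<epsilon> omega \<Longrightarrow> in_P P3 X (app \<Phi> i)"
    and L1: "\<And>i. i \<epsilon> omega \<Longrightarrow> in_L L1 X r D (app \<Phi> i)"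
begin

abbreviation phi :: "'v \<Rightarrow> 'v \<Rightarrow> 'v" where
  "phi i x \<equiv> app (app \<Phi> i) x"

abbreviation dist :: "'v \<Rightarrow> 'v \<Rightarrow> 'v \<Rightarrow> 'v" where
  "dist i x y \<equiv> app2 (app D i) x y"

abbreviation dom :: 'v where
  "dom \<equiv> Dom_family X \<Phi>"

lemma phi_fun: "i \<epsilon> omega \<Longrightarrow> is_fun (app \<Phi> i) X reals_pinf"
  using app_mem(1)[OF Phi_fun] by (simp add: mem_funspace)

lemma phi_reals_pinf: "i \<epsilon> omega \<Longrightarrow> x \<epsilon> X \<Longrightarrow> phi i x \<epsilon> reals_pinf"
  by (rule app_mem(1)[OF phi_fun])

lemma dist_semimetric: "i \<epsilon> omega \<Longrightarrow> semimetric X (app D i)"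
  using family unfolding semimetric_family_def by blast

lemma dist_fun: "i \<epsilon> omega \<Longrightarrow> is_fun (app D i) (cart X X) reals"
  using dist_semimetric unfolding semimetric_def by blast

lemma dist_real: "i \<epsilon> omega \<Longrightarrow> x \<epsilon> X \<Longrightarrow> y \<epsilon> X \<Longrightarrow> dist i x y \<epsilon> reals"
  unfolding app2_def by (rule app_mem(1)[OF dist_fun]) simp_all

lemma dist_nonneg: "i \<epsilon> omega \<Longrightarrow> x \<epsilon> X \<Longrightarrow> y \<epsilon> X \<Longrightarrow> zero \<preceq> dist i x y"
  using dist_semimetric unfolding semimetric_def by blast

lemma dist_sym: "i \<epsilon> omega \<Longrightarrow> x \<epsilon> X \<Longrightarrow> y \<epsilon> X \<Longrightarrow> dist i x y = dist i y x"
  using dist_semimetric unfolding semimetric_def by blast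

lemma dist_triangle:
  "i \<epsilon> omega \<Longrightarrow> x \<epsilon> X \<Longrightarrow> y \<epsilon> X \<Longrightarrow> z \<epsilon> X \<Longrightarrow> dist i x z \<preceq> dist i x y \<oplus> dist i y z"
  using dist_semimetric unfolding semimetric_def by blast

lemma dist_self: "i \<epsilon> omega \<Longrightarrow> x \<epsilon> X \<Longrightarrow> dist i x x = zero"
  using dist_semimetric unfolding semimetric_def by blast

lemma ap_phi: "i \<epsilon> omega \<Longrightarrow> x \<epsilon> X \<Longrightarrow> ap (ap \<Phi> i) x = phi i x"
  using ap_eq[OF Phi_fun] ap_eq[OF phi_fun] by simp

lemma ap_dist: "i \<epsilon> omega \<Longrightarrow> x \<epsilon> X \<Longrightarrow> y \<epsilon> X \<Longrightarrow> ap (ap D i) (opair x y) = dist i x y"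
proof -
  have "is_fun D omega (funspace (cart X X) reals)"
    using family unfolding semimetric_family_def by blast
  then show "i \<epsilon> omega \<Longrightarrow> x \<epsilon> X \<Longrightarrow> y \<epsilon> X \<Longrightarrow> ap (ap D i) (opair x y) = dist i x y"
    using ap_eq[OF dist_fun] unfolding app2_def by (simp add: ap_eq)
qed

lemma ap_add: "a \<epsilon> reals \<Longrightarrow> b \<epsilon> reals \<Longrightarrow> ap add (opair a b) = a \<oplus> b"
  unfolding app2_def using ap_eq[OF add_fun] by simp

lemma mem_Dom: "x \<epsilon> Dom X (app \<Phi> i) \<longleftrightarrow> x \<epsilon> X \<and> phi i x \<epsilon> reals" if i: "i \<epsilon> omega"
proof -
  have "(\<lambda>x. x \<epsilon> X \<and> phi i x \<sqsubset> pinf) = (\<lambda>x. x \<epsilon> X \<and> ap (app \<Phi> i) x \<epsilon> reals)"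
    using ext_less_pinf[OF phi_reals_pinf[OF i]] ap_eq[OF phi_fun[OF i]] by auto
  moreover have "x \<epsilon> set_of (\<lambda>x. x \<epsilon> X \<and> ap (app \<Phi> i) x \<epsilon> reals) \<longleftrightarrow> x \<epsilon> X \<and> ap (app \<Phi> i) x \<epsilon> reals"
    by (rule mem_set_of_definable[where A = X]) (intro definability, blast)
  ultimately show ?thesis
    using ap_eq[OF phi_fun[OF i]] unfolding Dom_def by auto
qed

lemma mem_dom: "x \<epsilon> dom \<longleftrightarrow> x \<epsilon> X \<and> (\<forall>i\<in>elts omega. phi i x \<epsilon> reals)"
proof -
  let ?P = "\<lambda>x. x \<epsilon> X \<and> (\<forall>i\<in>elts omega. ap (ap \<Phi> i) x \<epsilon> reals)"
  have eq: "(\<forall>i\<in>elts omega. x \<epsilon> Dom X (app \<Phi> i)) \<longleftrightarrow> ?P x" for x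
    using mem_Dom ap_phi empty_mem_omega by fastforce
  have "x \<epsilon> set_of ?P \<longleftrightarrow> ?P x"
    by (rule mem_set_of_definable[where A = X]) (intro definability, blast)
  then show ?thesis
    unfolding Dom_family_def eq using ap_phi by auto
qed

lemma dom_X: "x \<epsilon> dom \<Longrightarrow> x \<epsilon> X"
  by (simp add: mem_dom)

lemma phi_real: "i \<epsilon> omega \<Longrightarrow> x \<epsilon> dom \<Longrightarrow> phi i x \<epsilon> reals"
  by (simp add: mem_dom)

lemma phi_bounded_below:
  assumes i: "i \<epsilon> omega"
  obtains l where "l \<epsilon> reals" "\<And>x. x \<epsilon> dom \<Longrightarrow> l \<preceq> phi i x"
proof -
  let ?l = "range_inf X (app \<Phi> i)"
  obtain x0 where x0: "x0 \<epsilon> dom" using Dom_nonempty by blast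
  have le: "?l \<sqsubseteq> phi i x" if "x \<epsilon> dom" for x
    by (rule range_inf_le[OF phi_fun[OF i] dom_X[OF that]])
  have "?l \<noteq> minf"
    using P3[OF i] unfolding in_P.simps ext_less_def by metis
  moreover have "phi i x0 \<noteq> pinf" using phi_real[OF i x0] pinf_not_real by metis
  ultimately have l: "?l \<epsilon> reals" using le[OF x0] unfolding ext_le_def by blast
  have "?l \<preceq> phi i x" if "x \<epsilon> dom" for x
    using le[OF that] ext_le_real[OF l phi_real[OF i that]] by blast
  with l show ?thesis by (rule that)
qed

text \<open>
  The order of Ekeland and Brezis--Browder: going up from \<open>x\<close> to \<open>y\<close> is paid for by a decrease of
  every \<open>\<phi>\<^sub>i\<close>. The inequality is \<open>d\<^sub>i(x,y) \<le> \<phi>\<^sub>i(x) - \<phi>\<^sub>i(y)\<close> without subtraction, and \<open>ap\<close> makes the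
  predicate definable; \<open>below_iff\<close> is the intended reading.
\<close>

definition below :: "'v \<Rightarrow> 'v \<Rightarrow> bool" where
  "below x y \<longleftrightarrow> x \<epsilon> dom \<and> y \<epsilon> dom \<and> opair x y \<epsilon> r \<and>
     (\<forall>i\<in>elts omega. opair (ap add (opair (ap (ap D i) (opair x y)) (ap (ap \<Phi> i) y))) (ap (ap \<Phi> i) x) \<epsilon> ord)"

lemma definable_below:
  assumes "definable_term T" "definable_term U"
  shows "definable (\<lambda>s. below (T s) (U s))"
  unfolding below_def by (intro definability assms assms[THEN definable_term_shift])

lemma below_iff:
  "below x y \<longleftrightarrow> x \<epsilon> dom \<and> y \<epsilon> dom \<and> opair x y \<epsilon> r \<and>
     (\<forall>i\<in>elts omega. dist i x y \<oplus> phi i y \<preceq> phi i x)"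
proof (cases "x \<epsilon> dom \<and> y \<epsilon> dom")
  case True
  then have "ap add (opair (ap (ap D i) (opair x y)) (ap (ap \<Phi> i) y)) = dist i x y \<oplus> phi i y"
    "ap (ap \<Phi> i) x = phi i x" if "i \<epsilon> omega" for i
    using that by (simp_all add: ap_dist ap_phi ap_add dist_real dom_X phi_real)
  then show ?thesis unfolding below_def by simp
qed (unfold below_def, blast)

lemma below_dom:
  assumes "below x y"
  shows "x \<epsilon> dom" "y \<epsilon> dom"
  using assms unfolding below_def by blast+

lemma below_refl: "x \<epsilon> dom \<Longrightarrow> below x x"
  using order dom_X unfolding below_iff quasi_order_def
  by (simp add: dist_self zero_add phi_real ord_refl)

lemma below_phi:
  assumes "below x y" "i \<epsilon> omega"
  shows "phi i y \<preceq> phi i x"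
proof -
  note xy = below_dom[OF assms(1)]
  have "zero \<oplus> phi i y \<preceq> dist i x y \<oplus> phi i y"
    using xy assms(2) by (intro add_mono dist_nonneg dom_X phi_real)
  then have "phi i y \<preceq> dist i x y \<oplus> phi i y"
    using xy assms(2) by (simp add: zero_add phi_real)
  then show ?thesis using assms unfolding below_iff by (blast intro: ord_trans)
qed

lemma below_trans:
  assumes xy: "below x y" and yz: "below y z"
  shows "below x z"
proof -
  note mem = below_dom[OF xy] below_dom[OF yz]
  have "opair x z \<epsilon> r"
    using order xy yz dom_X unfolding below_iff quasi_order_def by blast
  moreover have "dist i x z \<oplus> phi i z \<preceq> phi i x" if i: "i \<epsilon> omega" for i
  proof -
    note rl = dist_real[OF i] phi_real[OF i] dom_X
    have "dist i x z \<oplus> phi i z \<preceq> (dist i x y \<oplus> dist i y z) \<oplus> phi i z"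
      using mem i by (intro add_mono dist_triangle rl)
    also have "(dist i x y \<oplus> dist i y z) \<oplus> phi i z = dist i x y \<oplus> (dist i y z \<oplus> phi i z)"
      using mem by (intro add_assoc rl)
    finally have "dist i x z \<oplus> phi i z \<preceq> dist i x y \<oplus> (dist i y z \<oplus> phi i z)" .
    moreover have "dist i x y \<oplus> (dist i y z \<oplus> phi i z) \<preceq> dist i x y \<oplus> phi i y"
      using yz i mem unfolding below_iff by (intro add_le_add ord_refl rl) blast+
    moreover have "dist i x y \<oplus> phi i y \<preceq> phi i x"
      using xy i unfolding below_iff by blast
    ultimately show ?thesis by (blast intro: ord_trans)
  qed
  ultimately show ?thesis using mem unfolding below_iff by blast
qed

text \<open>
  Up to \<open>e\<close>, the value \<open>\<phi>\<^sub>i(x)\<close> cannot be decreased any further by going up from \<open>x\<close>. This is inherited by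
  every point above \<open>x\<close>, so it can be achieved for one index \<open>i\<close> after the other. Its intended reading
  is \<open>near_iff\<close>.
\<close>

definition near :: "'v \<Rightarrow> 'v \<Rightarrow> 'v \<Rightarrow> bool" where
  "near i e x \<longleftrightarrow> (\<forall>y. below x y \<longrightarrow> opair (ap (ap \<Phi> i) x) (ap add (opair (ap (ap \<Phi> i) y) e)) \<epsilon> ord)"

lemma definable_near:
  assumes "definable_term T" "definable_term U" "definable_term V"
  shows "definable (\<lambda>s. near (T s) (U s) (V s))"
  unfolding near_def
  by (intro definability definable_below assms[THEN definable_term_shift])

lemma near_iff:
  assumes "i \<epsilon> omega" "e \<epsilon> reals" "x \<epsilon> dom"
  shows "near i e x \<longleftrightarrow> (\<forall>y. below x y \<longrightarrow> phi i x \<preceq> phi i y \<oplus> e)"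
proof -
  have "ap add (opair (ap (ap \<Phi> i) y) e) = phi i y \<oplus> e" if "below x y" for y
    using below_dom(2)[OF that] assms by (simp add: ap_phi ap_add dom_X phi_real)
  then show ?thesis unfolding near_def using assms ap_phi dom_X by auto
qed

lemma near_mono:
  assumes "near i e x" "below x y" "i \<epsilon> omega" "e \<epsilon> reals"
  shows "near i e y"
proof -
  note mem = below_dom[OF assms(2)]
  have "phi i y \<preceq> phi i z \<oplus> e" if "below y z" for z
  proof -
    have "phi i x \<preceq> phi i z \<oplus> e"
      using assms(1) below_trans[OF assms(2) that] near_iff[OF assms(3,4) mem(1)] by blast
    with below_phi[OF assms(2,3)] show ?thesis by (rule ord_trans)
  qed
  then show ?thesis using near_iff[OF assms(3,4) mem(2)] by blast
qed

text \<open>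
  As \<open>\<phi>\<^sub>i\<close> is bounded below, its values at the points above \<open>x\<close> have an infimum \<open>b\<close>, and a point \<open>y\<close>
  with \<open>\<phi>\<^sub>i(y) \<le> b + e\<close> is as required.
\<close>

lemma exists_near:
  assumes i: "i \<epsilon> omega" and e: "positive e" and x: "x \<epsilon> dom"
  obtains y where "below x y" "near i e y"
proof -
  note er = positive_real[OF e]
  have "definable (\<lambda>s. \<forall>y. below x y \<longrightarrow> opair (s 0) (ap (ap \<Phi> i) y) \<epsilon> ord)"
    by (intro definability definable_below)
  then obtain L where "l \<epsilon> L \<longleftrightarrow> l \<epsilon> reals \<and> (\<forall>y. below x y \<longrightarrow> l \<preceq> ap (ap \<Phi> i) y)" for l
    using definable_separation[of "\<lambda>l. \<forall>y. below x y \<longrightarrow> l \<preceq> ap (ap \<Phi> i) y" reals] by blast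
  then have L: "l \<epsilon> L \<longleftrightarrow> l \<epsilon> reals \<and> (\<forall>y. below x y \<longrightarrow> l \<preceq> phi i y)" for l
    using ap_phi[OF i] dom_X below_dom(2)[of x] by auto
  obtain l where "l \<epsilon> reals" "\<And>x. x \<epsilon> dom \<Longrightarrow> l \<preceq> phi i x"
    using phi_bounded_below[OF i] by blast
  then have "elts L \<noteq> {}" using below_dom(2)[of x] L by blast
  moreover have L_le: "l \<preceq> phi i y" if "l \<epsilon> L" "below x y" for l y
    using L that by blast
  ultimately obtain b where b: "b \<epsilon> reals" and ub: "\<forall>l\<in>elts L. l \<preceq> b"
    and least: "\<forall>c\<in>elts reals. (\<forall>l\<in>elts L. l \<preceq> c) \<longrightarrow> b \<preceq> c"
    using dedekind_complete[of L] L below_refl[OF x] phi_real[OF i x] by blast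
  have b_le: "b \<preceq> phi i y" if "below x y" for y
    using least L_le[OF _ that] phi_real[OF i below_dom(2)[OF that]] by blast
  have be: "b \<oplus> e \<epsilon> reals" using b er by (rule add_real)
  have "\<exists>y. below x y \<and> phi i y \<preceq> b \<oplus> e"
  proof (rule ccontr)
    assume "\<not> ?thesis"
    then have "b \<oplus> e \<preceq> phi i y" if "below x y" for y
      using that ord_total[OF be phi_real[OF i below_dom(2)[OF that]]] by blast
    then have "b \<oplus> e \<epsilon> L" using be L by blast
    then have "e \<oplus> b \<preceq> zero \<oplus> b" using ub b er by (simp add: zero_add add_commute)
    then have "e \<preceq> zero" using b er zero_real by (blast intro: add_le_cancel)
    then show False using e ord_antisym unfolding positive_def by blast
  qed
  then obtain y where y: "below x y" "phi i y \<preceq> b \<oplus> e" by blast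
  have "phi i y \<preceq> phi i z \<oplus> e" if "below y z" for z
    using y(2) add_mono[OF b_le[OF below_trans[OF y(1) that]] er] by (rule ord_trans)
  then have "near i e y" using near_iff[OF i er below_dom(2)[OF y(1)]] by blast
  with y(1) show ?thesis by (rule that)
qed

text \<open>
  Induction in the model serves finitely many indices at once. It also replaces finitely many choices
  of points, and their number may be non-standard.
\<close>

lemma exists_near_initial:
  assumes n: "n \<epsilon> omega" and e: "positive e" and x: "x \<epsilon> dom"
  shows "\<exists>y. below x y \<and> (\<forall>i\<in>elts n. near i e y)"
  using n
proof (induction n rule: omega_induct)
  case definable
  show ?case by (intro definability definable_below definable_near)
next
  case empty
  show ?case using below_refl[OF x] by auto
next
  case (succ n)
  then obtain y where y: "below x y" "\<forall>i\<in>elts n. near i e y" by blast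
  obtain z where z: "below y z" "near n e z"
    using exists_near[OF succ.hyps(1) e below_dom(2)[OF y(1)]] by blast
  have "near i e z" if "i \<epsilon> n" for i
    using near_mono[OF _ z(1) _ positive_real[OF e]] y(2) that mem_omega_mem[OF succ.hyps(1)] by blast
  then show ?case using z below_trans[OF y(1) z(1)] by auto
qed

text \<open>
  Infinitely many indices are served along one sequence, the \<open>n\<close>-th step being responsible for the
  indices \<open>i \<epsilon> n\<close> and the error \<open>\<eta>\<^sub>n\<close>, where \<open>\<eta>\<close> is a null sequence. In DC the admissible successors of a
  point may not depend on the number of the step. Instead of this number, the first level \<open>n\<close> that
  the point itself does not yet reach decides what its successor has to achieve.
\<close>

lemma approximating_sequence:
  assumes "DC" and u: "u \<epsilon> dom"
  obtains f where "is_fun f omega dom" "app f empty = u"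
    "\<And>n m. n \<epsilon> omega \<Longrightarrow> m \<epsilon> omega \<Longrightarrow> nat_le n m \<Longrightarrow> below (app f n) (app f m)"
    "\<And>i e. i \<epsilon> omega \<Longrightarrow> positive e \<Longrightarrow> \<exists>e'\<in>elts reals. e' \<sqsubset> e \<and>
       (\<exists>N\<in>elts omega. \<forall>n\<in>elts omega. nat_le N n \<longrightarrow> near i e' (app f n))"
proof -
  obtain \<eta> where eta: "is_fun \<eta> omega reals" "\<And>n. n \<epsilon> omega \<Longrightarrow> positive (app \<eta> n)"
    and eta_mono: "\<And>n m. n \<epsilon> omega \<Longrightarrow> m \<epsilon> omega \<Longrightarrow> nat_le n m \<Longrightarrow> app \<eta> m \<preceq> app \<eta> n"
    and eta_small: "\<And>e. positive e \<Longrightarrow> \<exists>n\<in>elts omega. \<not> e \<preceq> app \<eta> n"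
    using null_sequence[OF \<open>DC\<close>] by blast
  define good where "good n x \<longleftrightarrow> (\<forall>i\<in>elts n. near i (ap \<eta> n) x)" for n x
  have definable_good: "definable (\<lambda>s. good (T s) (U s))" if "definable_term T" "definable_term U" for T U
    unfolding good_def
    by (intro definability definable_near that that[THEN definable_term_shift])
  have good_mono: "good n y" if "good n x" "below x y" "n \<epsilon> omega" for n x y
  proof -
    have "ap \<eta> n \<epsilon> reals"
      unfolding ap_eq[OF eta(1) that(3)] by (rule app_mem(1)[OF eta(1) that(3)])
    then show ?thesis
      using near_mono[OF _ that(2)] that(1) mem_omega_mem[OF that(3)] unfolding good_def by blast
  qed
  \<comment> \<open>A point that reaches all levels
    improves itself; for any other point the first missing level must be gained, as the levels before
    it are inherited.\<close>
  define improves where "improves x y \<longleftrightarrow>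
    below x y \<and> (\<forall>n\<in>elts omega. (\<forall>k\<in>elts n. good k x) \<longrightarrow> good n y)" for x y
  have "definable (\<lambda>s. improves (s 0) (s 1))"
    unfolding improves_def by (intro definability definable_below definable_good)
  moreover have "\<exists>y. y \<epsilon> dom \<and> improves x y" if x: "x \<epsilon> dom" for x
  proof (cases "\<forall>n\<in>elts omega. good n x")
    case True
    then have "improves x x" unfolding improves_def using below_refl[OF x] by blast
    with x show ?thesis by blast
  next
    case False
    have "definable (\<lambda>s. \<not> good (s 0) x)" by (intro definability definable_good)
    note least = least_nat[of "\<lambda>n. \<not> good n x", OF this]
    obtain n0 where n0: "n0 \<epsilon> omega" "\<not> good n0 x" using False by blast
    obtain n where n: "n \<epsilon> omega" "\<not> good n x" and before: "\<And>k. k \<epsilon> n \<Longrightarrow> \<not> \<not> good k x"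
      by (rule least[OF n0]) (rule that)
    obtain y where y: "below x y" "\<forall>i\<in>elts n. near i (app \<eta> n) y"
      using exists_near_initial[OF n(1) eta(2)[OF n(1)] x] by blast
    have "good m y" if m: "m \<epsilon> omega" "\<forall>k\<in>elts m. good k x" for m
    proof (cases "m = n")
      case True
      then show ?thesis using y(2) ap_eq[OF eta(1) n(1)] unfolding good_def by simp
    next
      case False
      then have "m \<epsilon> n" using nat_le_linear[OF m(1) n(1)] m(2) n(2) unfolding nat_le_def by blast
      then show ?thesis using before good_mono y(1) m(1) by blast
    qed
    then have "improves x y" unfolding improves_def using y(1) by blast
    then show ?thesis using below_dom(2)[OF y(1)] by blast
  qed
  ultimately obtain f where f: "is_fun f omega dom" "app f empty = u"
    and step: "\<And>n. n \<epsilon> omega \<Longrightarrow> improves (app f n) (app f (succ n))"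
    using dependent_choice[OF \<open>DC\<close>, of improves u dom] u by blast
  have "definable (\<lambda>s. below (s 0) (s 1))" by (intro definable_below definability)
  note rel = relation_exists[of below dom, OF this]
  obtain q where "is_rel q dom"
    and q: "\<And>x y. opair x y \<epsilon> q \<longleftrightarrow> x \<epsilon> dom \<and> y \<epsilon> dom \<and> below x y"
    by (rule rel) (rule that)
  have chain: "below (app f n) (app f m)" if "n \<epsilon> omega" "m \<epsilon> omega" "nat_le n m" for n m
  proof -
    have "opair (app f n) (app f m) \<epsilon> q"
    proof (rule chain_related[OF f(1) _ _ _ that])
      show "opair (app f n) (app f (succ n)) \<epsilon> q" if "n \<epsilon> omega" for n
        using step[OF that] below_dom unfolding improves_def q by blast
    qed (use q below_refl below_trans in blast)+
    then show ?thesis using q by blast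
  qed
  have levels: "\<forall>k\<in>elts n. good k (ap f n)" if "n \<epsilon> omega" for n
    using that
  proof (induction n rule: omega_induct)
    case definable
    show ?case by (intro definability definable_good)
  next
    case empty
    show ?case by simp
  next
    case (succ n)
    note n = succ.hyps(1)
    have IH: "\<forall>k\<in>elts n. good k (app f n)" using succ.IH ap_eq[OF f(1) n] by simp
    have "good n (app f (succ n))" using step[OF n] IH n unfolding improves_def by blast
    moreover have "good k (app f (succ n))" if "k \<epsilon> n" for k
      using good_mono[of k "app f n"] IH that step[OF n] mem_omega_mem[OF n] unfolding improves_def by blast
    ultimately show ?case using ap_eq[OF f(1) succ_mem_omega[OF n]] by auto
  qed
  have "\<exists>e'\<in>elts reals. e' \<sqsubset> e \<and>
       (\<exists>N\<in>elts omega. \<forall>n\<in>elts omega. nat_le N n \<longrightarrow> near i e' (app f n))"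
    if i: "i \<epsilon> omega" and e: "positive e" for i e
  proof -
    obtain n0 where n0: "n0 \<epsilon> omega" "\<not> e \<preceq> app \<eta> n0" using eta_small[OF e] by blast
    obtain N where N: "N \<epsilon> omega" "nat_le n0 N" "nat_le (succ i) N"
      using nat_le_upper[OF n0(1) succ_mem_omega[OF i]] by blast
    let ?e = "app \<eta> N"
    have er: "?e \<epsilon> reals" "e \<epsilon> reals" using eta(2)[OF N(1)] e positive_real by auto
    have "\<not> e \<preceq> ?e" using n0 eta_mono[OF n0(1) N(1,2)] ord_trans by blast
    then have "?e \<sqsubset> e" using not_le[of e ?e] er ext_le_real unfolding ext_less_def by blast
    moreover have "near i ?e (app f n)" if n: "n \<epsilon> omega" "nat_le (succ N) n" for n
    proof -
      have "N \<epsilon> n" using mem_nat_le_trans[OF _ n(2,1), of N] by simp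
      moreover have "i \<epsilon> N" using mem_nat_le_trans[OF _ N(3,1), of i] by simp
      ultimately show ?thesis
        using levels[OF n(1)] ap_eq[OF f(1) n(1)] ap_eq[OF eta(1) N(1)] unfolding good_def by auto
    qed
    ultimately show ?thesis using er(1) succ_mem_omega[OF N(1)] by blast
  qed
  with f chain show ?thesis by (rule that)
qed

text \<open>
  The point \<open>v\<close> is the limit of the approximating sequence. The sequence is Cauchy because, from some
  point on, the values of \<open>\<phi>\<^sub>i\<close> and hence the distances vary by less than \<open>e\<close>. By completeness and
  self-closedness the limit exists and lies above the sequence with respect to \<open>r\<close>; (L1) makes it lie
  above the sequence in the finer order. Every point \<open>x\<close> above \<open>v\<close> is then also above the sequence, so
  \<open>\<phi>\<^sub>i(v)\<close> exceeds \<open>\<phi>\<^sub>i(x)\<close> by at most each \<open>e\<close>, which forces \<open>d\<^sub>i(v,x) = 0\<close> for every \<open>i\<close>.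
\<close>

theorem maximal_above:
  assumes "DC" and u: "u \<epsilon> dom"
  obtains v where "below u v" "\<And>x. below v x \<Longrightarrow> x = v"
proof -
  obtain f where f: "is_fun f omega dom" "app f empty = u"
    and chain: "\<And>n m. n \<epsilon> omega \<Longrightarrow> m \<epsilon> omega \<Longrightarrow> nat_le n m \<Longrightarrow> below (app f n) (app f m)"
    and near: "\<And>i e. i \<epsilon> omega \<Longrightarrow> positive e \<Longrightarrow> \<exists>e'\<in>elts reals. e' \<sqsubset> e \<and>
       (\<exists>N\<in>elts omega. \<forall>n\<in>elts omega. nat_le N n \<longrightarrow> near i e' (app f n))"
    using approximating_sequence[OF assms] by blast
  have fX: "is_fun f omega X" using f(1) dom_X by (blast intro: is_fun_subset)
  note f_dom = app_mem(1)[OF f(1)] and f_X = app_mem(1)[OF fX]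
  have asc: "ascending r f" unfolding ascending_def using chain below_iff by blast
  have desc: "descending_along (app \<Phi> i) f" if i: "i \<epsilon> omega" for i
    unfolding descending_along_def using below_phi[OF chain i] ext_le_real le_real by blast
  have close: "dist i (app f m) (app f n) \<sqsubset> e"
    if i: "i \<epsilon> omega" and m: "m \<epsilon> omega" and n: "n \<epsilon> omega" and mn: "nat_le m n"
      and e': "e' \<epsilon> reals" "e' \<sqsubset> e" "e \<epsilon> reals" and nr: "near i e' (app f m)" for i m n e e'
  proof -
    have b: "below (app f m) (app f n)" using m n mn by (rule chain)
    have "dist i (app f m) (app f n) \<oplus> phi i (app f n) \<preceq> phi i (app f m)"
      using b i unfolding below_iff by blast
    moreover have "phi i (app f m) \<preceq> e' \<oplus> phi i (app f n)"
      using nr b near_iff[OF i e'(1) f_dom[OF m]]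
      unfolding add_commute[OF e'(1) phi_real[OF i f_dom[OF n]]] by blast
    ultimately have "dist i (app f m) (app f n) \<oplus> phi i (app f n) \<preceq> e' \<oplus> phi i (app f n)"
      by (rule ord_trans)
    then have le: "dist i (app f m) (app f n) \<preceq> e'"
      by (rule add_le_cancel) (use i m n e' in \<open>auto intro: dist_real phi_real f_X f_dom\<close>)
    have "e' \<preceq> e" "e' \<noteq> e" using e' ext_le_real unfolding ext_less_def by blast+
    then have "dist i (app f m) (app f n) \<preceq> e" "dist i (app f m) (app f n) \<noteq> e"
      using le ord_trans ord_antisym by blast+
    then show ?thesis using ext_le_real le_real unfolding ext_less_def by blast
  qed
  have "D_Cauchy D f"
    unfolding D_Cauchy_def
  proof (intro ballI impI, unfold mem_Collect_eq)
    fix i e assume i: "i \<epsilon> omega" and e: "e \<epsilon> reals" "zero \<sqsubset> e"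
    obtain e' N where e': "e' \<epsilon> reals" "e' \<sqsubset> e" and N: "N \<epsilon> omega"
      and nr: "\<forall>n\<in>elts omega. nat_le N n \<longrightarrow> near i e' (app f n)"
      using near[OF i ext_less_zero[OF e(2,1)]] by blast
    have "dist i (app f m) (app f n) \<sqsubset> e"
      if m: "m \<epsilon> omega" "nat_le N m" and n: "n \<epsilon> omega" "nat_le N n" for m n
      using nat_le_linear[OF m(1) n(1)]
    proof
      assume "nat_le m n"
      then show ?thesis using close[OF i m(1) n(1) _ e' e(1)] nr m by blast
    next
      assume "nat_le n m"
      then have "dist i (app f n) (app f m) \<sqsubset> e" using close[OF i n(1) m(1) _ e' e(1)] nr n by blast
      then show ?thesis using dist_sym[OF i f_X[OF m(1)] f_X[OF n(1)]] by simp
    qed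
    then show "\<exists>N\<in>elts omega. \<forall>m\<in>elts omega. \<forall>n\<in>elts omega. nat_le N m \<and> nat_le N n \<longrightarrow>
        dist i (app f m) (app f n) \<sqsubset> e"
      using N by blast
  qed
  then obtain v where v: "v \<epsilon> X" and lim: "D_limit D f v"
    using strongly_complete fX asc unfolding strongly_complete_def complete_def by blast
  have f_le_v: "opair (app f n) v \<epsilon> r" if "n \<epsilon> omega" for n
    using strongly_complete fX asc v lim that unfolding strongly_complete_def self_closed_def by blast
  have phi_v_ext: "phi i v \<sqsubseteq> phi i (app f n)" if i: "i \<epsilon> omega" and n: "n \<epsilon> omega" for i n
    using L1[OF i] fX asc v lim f_le_v desc[OF i] n unfolding in_L.simps by blast
  have "phi i v \<epsilon> reals" if i: "i \<epsilon> omega" for i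
    using phi_v_ext[OF i empty_mem_omega] phi_real[OF i f_dom[OF empty_mem_omega]]
      phi_reals_pinf[OF i v] pinf_not_real pinf_neq_minf
    unfolding ext_le_def mem_reals_pinf by metis
  then have v_dom: "v \<epsilon> dom" using v mem_dom by blast
  have phi_v: "phi i v \<preceq> phi i (app f n)" if i: "i \<epsilon> omega" and n: "n \<epsilon> omega" for i n
    using phi_v_ext[OF i n] ext_le_real phi_real[OF i] v_dom f_dom[OF n] by blast
  have f_below_v: "below (app f n) v" if n: "n \<epsilon> omega" for n
  proof -
    have "dist i (app f n) v \<oplus> phi i v \<preceq> phi i (app f n)" if i: "i \<epsilon> omega" for i
    proof (rule le_if_le_add_positive)
      note rl = dist_real[OF i] phi_real[OF i] v v_dom f_X f_dom n
      show "dist i (app f n) v \<oplus> phi i v \<epsilon> reals" by (intro add_real rl)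
      show "phi i (app f n) \<epsilon> reals" by (intro rl)
      fix e assume e: "positive e"
      then obtain N where N: "N \<epsilon> omega"
        and small: "\<forall>n\<in>elts omega. nat_le N n \<longrightarrow> dist i (app f n) v \<sqsubset> e"
        using lim positive_ext_less[OF e] positive_real[OF e] i unfolding D_limit_def by blast
      obtain m where m: "m \<epsilon> omega" "nat_le N m" "nat_le n m" using nat_le_upper[OF N n] by blast
      have dm: "dist i (app f m) v \<preceq> e"
        using small m ext_le_real positive_real[OF e] dist_real[OF i f_X[OF m(1)] v]
        unfolding ext_less_def by blast
      \<comment> \<open>For late \<open>m\<close>, compare along \<open>f n\<close>, \<open>f m\<close>, \<open>v\<close>: the first leg is paid for by the order, the second
        is at most \<open>e\<close>.\<close>
      let ?nm = "dist i (app f n) (app f m)" and ?mv = "dist i (app f m) v"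
      have "dist i (app f n) v \<oplus> phi i v \<preceq> (?nm \<oplus> ?mv) \<oplus> phi i (app f m)"
        by (intro add_le_add dist_triangle phi_v i rl m)
      moreover have "(?nm \<oplus> ?mv) \<oplus> phi i (app f m) = (?nm \<oplus> phi i (app f m)) \<oplus> ?mv"
      proof -
        have *: "?nm \<epsilon> reals" "?mv \<epsilon> reals" "phi i (app f m) \<epsilon> reals" by (intro rl m)+
        then show ?thesis using add_commute[OF *(2,3)] by (simp add: add_assoc)
      qed
      moreover have "(?nm \<oplus> phi i (app f m)) \<oplus> ?mv \<preceq> phi i (app f n) \<oplus> e"
        using chain[OF n m(1,3)] i dm unfolding below_iff by (blast intro: add_le_add)
      ultimately show "dist i (app f n) v \<oplus> phi i v \<preceq> phi i (app f n) \<oplus> e"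
        using ord_trans by metis
    qed
    then show ?thesis using f_le_v[OF n] f_dom[OF n] v_dom unfolding below_iff by blast
  qed
  have "below u v" using f_below_v[OF empty_mem_omega] f(2) by simp
  moreover have "x = v" if vx: "below v x" for x
  proof -
    note x = below_dom(2)[OF vx]
    have "dist i v x = zero" if i: "i \<epsilon> omega" for i
    proof -
      have "phi i v \<preceq> phi i x"
      proof (rule le_if_le_add_positive[OF phi_real[OF i v_dom] phi_real[OF i x]])
        fix e assume e: "positive e"
        obtain e' N where e': "e' \<epsilon> reals" "e' \<sqsubset> e" and N: "N \<epsilon> omega"
          and nr: "\<forall>n\<in>elts omega. nat_le N n \<longrightarrow> near i e' (app f n)"
          using near[OF i e] by blast
        have "near i e' (app f N)" using nr N nat_le_refl by blast
        then have "phi i (app f N) \<preceq> phi i x \<oplus> e'"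
          using near_iff[OF i e'(1) f_dom[OF N]] below_trans[OF f_below_v[OF N] vx] by blast
        moreover have "phi i x \<oplus> e' \<preceq> phi i x \<oplus> e"
          using e' ext_le_real positive_real[OF e] unfolding ext_less_def
          by (intro add_le_add ord_refl phi_real i x) blast
        ultimately show "phi i v \<preceq> phi i x \<oplus> e"
          using phi_v[OF i N] by (blast intro: ord_trans)
      qed
      moreover have "dist i v x \<oplus> phi i x \<preceq> phi i v" using vx i unfolding below_iff by blast
      ultimately have "dist i v x \<oplus> phi i x \<preceq> zero \<oplus> phi i x"
        using zero_add[OF phi_real[OF i x]] by (auto intro: ord_trans)
      then have "dist i v x \<preceq> zero"
        by (rule add_le_cancel) (intro dist_real phi_real i v x dom_X zero_real)+
      then show ?thesis using dist_nonneg[OF i v dom_X[OF x]] by (rule ord_antisym)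
    qed
    then show ?thesis using suff v dom_X[OF x] unfolding sufficient_def by blast
  qed
  ultimately show ?thesis by (rule that)
qed

text \<open>
  Maximality of \<open>v\<close> is the last clause: if no index \<open>i\<close> were as claimed, then every \<open>\<phi>\<^sub>i(x)\<close> would
  be finite, since \<open>\<phi>\<^sub>i(x) = \<infinity>\<close> makes the difference \<open>- \<infinity>\<close>, and \<open>x\<close> would lie above \<open>v\<close>.
\<close>

lemma variational_principle:
  assumes "DC" and u: "u \<epsilon> dom"
  shows "\<exists>v\<in>elts dom. opair u v \<epsilon> r \<and>
     (\<forall>i\<in>elts omega. dist i u v \<sqsubseteq> phi i u \<ominus> phi i v) \<and>
     (\<forall>x\<in>elts X. opair v x \<epsilon> r \<and> x \<noteq> v \<longrightarrow> (\<exists>i\<in>elts omega. phi i v \<ominus> phi i x \<sqsubset> dist i v x))"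
proof -
  obtain v where uv: "below u v" and max: "\<And>x. below v x \<Longrightarrow> x = v"
    using maximal_above[OF assms] by blast
  note v = below_dom(2)[OF uv]
  have "dist i u v \<sqsubseteq> phi i u \<ominus> phi i v" if i: "i \<epsilon> omega" for i
  proof -
    note rl = phi_real[OF i u] phi_real[OF i v] dist_real[OF i dom_X[OF u] dom_X[OF v]]
    have "dist i u v \<preceq> phi i u \<ominus> phi i v"
      using uv i le_diff_iff[OF rl] unfolding below_iff by blast
    then show ?thesis using ext_le_real le_real by blast
  qed
  moreover have "\<exists>i\<in>elts omega. phi i v \<ominus> phi i x \<sqsubset> dist i v x"
    if x: "x \<epsilon> X" and vx: "opair v x \<epsilon> r" and neq: "x \<noteq> v" for x
  proof (rule ccontr)
    assume not_less: "\<not> ?thesis"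
    have real: "phi i x \<epsilon> reals" if i: "i \<epsilon> omega" for i
    proof (rule ccontr)
      assume "\<not> phi i x \<epsilon> reals"
      then have "phi i x = pinf" using phi_reals_pinf[OF i x] mem_reals_pinf by blast
      then have "phi i v \<ominus> phi i x = minf" by (simp add: ext_diff_def)
      moreover have "dist i v x \<noteq> minf" using dist_real[OF i dom_X[OF v] x] minf_not_real by metis
      ultimately have "phi i v \<ominus> phi i x \<sqsubset> dist i v x" unfolding ext_less_def ext_le_def by simp
      then show False using not_less i by blast
    qed
    then have x_dom: "x \<epsilon> dom" using x mem_dom by blast
    have "dist i v x \<oplus> phi i x \<preceq> phi i v" if i: "i \<epsilon> omega" for i
    proof -
      note rl = phi_real[OF i v] real[OF i] dist_real[OF i dom_X[OF v] x]
      have "\<not> phi i v \<ominus> phi i x \<sqsubset> dist i v x" using not_less i by blast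
      then have "dist i v x \<preceq> phi i v \<ominus> phi i x"
        using ext_le_real[OF diff_real(1)[OF rl(1,2)] rl(3)] ord_total[OF diff_real(1)[OF rl(1,2)] rl(3)]
          ord_refl[OF rl(3)]
        unfolding ext_less_def by metis
      then show ?thesis using le_diff_iff[OF rl] by blast
    qed
    then have "below v x" unfolding below_iff using v x_dom vx by blast
    then show False using max neq by blast
  qed
  ultimately show ?thesis using v uv unfolding below_iff by blast
qed

end

context ZF_real_line
begin

text \<open>
  The classes are nested: (P4) is contained in (P3), (L3) in (L2), and (L2) in (L1).
\<close>

lemma EVPg_over_if_DC:
  assumes "DC"
  shows "EVPg_over j k"
  unfolding EVPg_over_def
proof (intro allI impI, elim conjE)
  fix X r D \<Phi>
  assume \<Phi>: "is_fun \<Phi> omega (funspace X reals_pinf)"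
    and P: "\<forall>i\<in>elts omega. in_P j X (app \<Phi> i)" and L: "\<forall>i\<in>elts omega. in_L k X r D (app \<Phi> i)"
  have fun_\<Phi>: "is_fun (app \<Phi> i) X reals_pinf" if "i \<epsilon> omega" for i
    using app_mem(1)[OF \<Phi> that] by (simp add: mem_funspace)
  have "in_P P3 X (app \<Phi> i)" if "i \<epsilon> omega" for i
    using P that in_P4_imp_in_P3 by (cases j) auto
  moreover have "in_L L1 X r D (app \<Phi> i)" if "i \<epsilon> omega" for i
  proof -
    have "in_L k X r D (app \<Phi> i)" using L that by blast
    then show ?thesis
      using in_L2_imp_in_L1 in_L3_imp_in_L2[OF fun_\<Phi>[OF that]] by (cases k) blast+
  qed
  moreover assume "quasi_order X r" "semimetric_family X D" "sufficient X D"
    "strongly_complete X r D" "elts (Dom_family X \<Phi>) \<noteq> {}"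
  ultimately interpret variational_problem mem reals add mul zero one ord pinf minf X r D \<Phi>
    using \<Phi> by unfold_locales
  show "\<forall>u\<in>elts dom. \<exists>v\<in>elts dom. opair u v \<epsilon> r \<and>
     (\<forall>i\<in>elts omega. dist i u v \<sqsubseteq> phi i u \<ominus> phi i v) \<and>
     (\<forall>x\<in>elts X. opair v x \<epsilon> r \<and> x \<noteq> v \<longrightarrow> (\<exists>i\<in>elts omega. phi i v \<ominus> phi i x \<sqsubset> dist i v x))"
    using variational_principle[OF \<open>DC\<close>] by blast
qed

end

theorem proposition8:
  fixes mem :: "'v \<Rightarrow> 'v \<Rightarrow> bool"
  assumes "ZF mem"
    and "membership.DC mem"
  shows "membership.EVPg mem P3 L1 \<and> (\<forall>j k. membership.EVPg mem j k)"
proof -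
  have "membership.EVPg mem j k" for j k
    unfolding membership.EVPg_def
  proof (intro allI impI)
    fix reals add mul zero one ord pinf minf
    assume "real_line mem reals add mul zero one ord pinf minf"
    with assms(1) interpret ZF_real_line mem reals add mul zero one ord pinf minf
      by (rule ZF_real_line.intro)
    show "EVPg_over j k" using assms(2) by (rule EVPg_over_if_DC)
  qed
  then show ?thesis by blast
qed

end
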